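(* Let $\mathrm{tree}$ denote the class of all trees. Then, for integers $k\ge 1$: \begin{itemize} \item $\pi_1(\mathrm{tree})=4$; \item $\pi_k(\mathrm{tree})=3$ for $2\le k\le 4$; \item $\pi_k(\mathrm{tree})=2$ for every $k\ge 5$. \end{itemize}
   Context: Graphs are finite, simple and undirected; a coloring of a graph is an assignment of colors to its vertices (not required to be proper unless stated). A square is a word of the form $uu$ with $u$ a nonempty word; its period is $|u|$, the length of $u$. A coloring of a graph $G$ contains a square of period $p$ if there is a (simple, not necessarily induced) path $v_1v_2\cdots v_{2p}$ in $G$, with distinct vertices and consecutive vertices adjacent, whose sequence of colors is a square of period $p$, i.e. $v_i$ and $v_{i+p}$ have the same color for all $1\le i\le p$. For an integer $k\ge 1$, $\pi_k(G)$ is the minimum number of colors needed to color $G$ such that no square of period at least $k$ appears in $G$. For a class $C$ of graphs, $\pi_k(C)$ is the supremum of $\pi_k(G)$ over all $G\in C$. *)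

theory Defs
  imports
    "Graph_Theory.Graph_Theory"
    "HOL-Library.Extended_Nat"
    "HOL-Library.Infinite_Typeclass"
begin

text \<open>
  A finite simple undirected graph is an element of the locale \<^locale>\<open>pair_graph\<close>: a finite
  symmetric loop-free digraph without parallel arcs, in which an edge is represented by its two
  opposite arcs. A path is a \<^const>\<open>vpath\<close>, i.e. a nonempty list of distinct, consecutively
  adjacent vertices.
\<close>

definition square_word :: "nat \<Rightarrow> 'c list \<Rightarrow> bool" where
  "square_word p w \<longleftrightarrow> (\<exists>u. u \<noteq> [] \<and> length u = p \<and> w = u @ u)"

definition contains_square :: "'a pair_pre_digraph \<Rightarrow> ('a \<Rightarrow> 'c) \<Rightarrow> nat \<Rightarrow> bool" where
  "contains_square G c p \<longleftrightarrow> (\<exists>vs. vpath vs (with_proj G) \<and> square_word p (map c vs))"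

text \<open>Colorings with \<open>n\<close> colors are taken with values in \<open>{..<n}\<close>; not all values need be used.\<close>

definition avoiding_colorable :: "nat \<Rightarrow> 'a pair_pre_digraph \<Rightarrow> nat \<Rightarrow> bool" where
  "avoiding_colorable k G n \<longleftrightarrow>
     (\<exists>c :: 'a \<Rightarrow> nat. c ` pverts G \<subseteq> {..<n} \<and> (\<forall>p\<ge>k. \<not> contains_square G c p))"

definition pi_graph :: "nat \<Rightarrow> 'a pair_pre_digraph \<Rightarrow> nat" where
  "pi_graph k G = (LEAST n. avoiding_colorable k G n)"

definition pi_class :: "nat \<Rightarrow> 'a pair_pre_digraph set \<Rightarrow> enat" where
  "pi_class k C = (SUP G\<in>C. enat (pi_graph k G))"

text \<open>
  The library predicate \<^const>\<open>Digraph_Component.tree\<close> is not usable here: it is about directed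
  cycles, so that in a symmetric digraph every edge \<open>a b\<close> gives the cycle \<open>a, b, a\<close>.
  A cycle of an undirected graph has at least three vertices.
  Note that \<^const>\<open>Digraph_Component.connected\<close> excludes the graph without vertices.
\<close>

definition has_cycle :: "'a pair_pre_digraph \<Rightarrow> bool" where
  "has_cycle G \<longleftrightarrow>
     (\<exists>vs. vpath vs (with_proj G) \<and> 3 \<le> length vs \<and> (last vs, hd vs) \<in> parcs G)"

definition trees :: "'a pair_pre_digraph set" where
  "trees = {G. pair_graph G \<and> Digraph_Component.connected (with_proj G) \<and> \<not> has_cycle G}"

text \<open>The minimum defining \<^const>\<open>pi_graph\<close> is attained: color the vertices injectively.\<close>

lemma avoiding_colorable_pi_graph:
  assumes "pair_graph G"
  shows "avoiding_colorable k G (pi_graph k G)"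
proof -
  interpret pair_graph G by fact
  obtain c :: "'a \<Rightarrow> nat" and n where c: "c ` pverts G = {i. i < n}" "inj_on c (pverts G)"
    using finite_imp_inj_to_nat_seg[OF pair_finite_verts] by blast
  have "\<not> contains_square G c p" for p
  proof
    assume "contains_square G c p"
    then obtain vs u where vs: "set vs \<subseteq> pverts G" "distinct vs"
      and u: "u \<noteq> []" "map c vs = u @ u"
      unfolding contains_square_def square_word_def vpath_def vwalk_def by auto
    have "distinct (map c vs)"
      using vs c(2) by (simp add: distinct_map inj_on_subset)
    with u show False by simp
  qed
  with c(1) have "avoiding_colorable k G n"
    unfolding avoiding_colorable_def by auto
  then show ?thesis
    unfolding pi_graph_def by (rule LeastI)
qed

end

theory Submission
  imports Defs
begin

text \<open>
  Color a rooted tree by depth, according to a word \<open>w\<close>. The depths along a path decrease and then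
  increase in steps of one, so that a square on a path is a \<^emph>\<open>folded square\<close> of \<open>w\<close>: the word
  \<open>w\<^bsub>m + t\<^esub> \<dots> w\<^bsub>m + 1\<^esub> w\<^bsub>m\<^esub> w\<^bsub>m + 1\<^esub> \<dots>\<close> of length \<open>2 * p\<close> is a square. Conversely, by the pigeonhole
  principle every coloring of a complete tree of large arity with \<open>C\<close> colors is a coloring by
  depth on some complete binary subtree. Hence trees can be colored with \<open>C\<close> colors if and only if
  there are arbitrarily long words over \<open>C\<close> letters without folded squares of period at least \<open>k\<close>.

  Such words with 4, 3 and 2 letters, for \<open>k = 1, 2, 5\<close>, are images of ternary square-free words
  under uniform morphisms of lengths 5, 12 and 20. A long folded square in an image contains a
  long palindrome, which does not occur, or a repetition that is almost a square and pulls back to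
  a square. This leaves finitely many short folded squares to be excluded. In the other direction,
  backtracking shows that ternary words of length 6 contain a folded square, and that binary words
  of length 15 contain a folded square of period at least 4.
\<close>

section \<open>Folded squares\<close>

fun lcp :: "'a list \<Rightarrow> 'a list \<Rightarrow> nat" where
  "lcp (x # xs) (y # ys) = (if x = y then Suc (lcp xs ys) else 0)"
| "lcp _ _ = 0"

lemma le_lcp_iff:
  "n \<le> lcp xs ys \<longleftrightarrow> n \<le> length xs \<and> n \<le> length ys \<and> (\<forall>i<n. xs ! i = ys ! i)"
proof (induction xs ys arbitrary: n rule: lcp.induct)
  case (1 x xs y ys)
  show ?case
  proof (cases n)
    case (Suc n')
    then show ?thesis
      by (auto simp: "1.IH" All_less_Suc2)
  qed simp
qed auto

text \<open>
  The left index is \<open>m + \<bar>i - t\<bar>\<close>. For \<open>t < p\<close>, the fold at \<open>i = t\<close> lies in the first half of the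
  square; the other case is the same up to reversal of the path.
\<close>

definition fold_square :: "(nat \<Rightarrow> 'c) \<Rightarrow> nat \<Rightarrow> nat \<Rightarrow> nat \<Rightarrow> bool" where
  "fold_square w m t p \<longleftrightarrow> (\<forall>i<p. w (m + ((i - t) + (t - i))) = w (m + (i + p - t)))"

text \<open>With \<open>j = i - t\<close> after the fold and \<open>j = t - i\<close> before it, the
  word leaving \<open>m\<close> to the right is compared with the words leaving \<open>m + p\<close>
  in both directions. The case \<open>i = t\<close> appears on both sides as
  \<open>j = 0\<close>.\<close>

lemma fold_square_iff:
  assumes "t < p"
  shows "fold_square w m t p \<longleftrightarrow>
    (\<forall>j<p - t. w (m + j) = w (m + p + j)) \<and> (\<forall>j\<le>t. w (m + j) = w (m + p - j))"
proof (intro iffI conjI allI impI)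
  assume *: "fold_square w m t p"
  { fix j assume "j < p - t"
    with *[unfolded fold_square_def, rule_format, of "t + j"]
    show "w (m + j) = w (m + p + j)" by (simp add: algebra_simps)
  next
    fix j assume "j \<le> t"
    with *[unfolded fold_square_def, rule_format, of "t - j"] assms
    show "w (m + j) = w (m + p - j)" by (simp add: algebra_simps)
  }
next
  assume *: "(\<forall>j<p - t. w (m + j) = w (m + p + j)) \<and> (\<forall>j\<le>t. w (m + j) = w (m + p - j))"
  show "fold_square w m t p"
    unfolding fold_square_def
  proof (intro allI impI)
    fix i assume "i < p"
    show "w (m + ((i - t) + (t - i))) = w (m + (i + p - t))"
    proof (cases "i < t")
      case True
      then have "t - i \<le> t" "m + p - (t - i) = m + (i + p - t)" using assms by auto
      with * True show ?thesis by (metis add.left_neutral diff_is_0_eq less_imp_le)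
    next
      case False
      then have "i - t < p - t" "m + p + (i - t) = m + (i + p - t)" using \<open>i < p\<close> by auto
      with * False show ?thesis by (metis add.right_neutral diff_is_0_eq not_less)
    qed
  qed
qed

lemma fold_square_0: "fold_square w m 0 p \<longleftrightarrow> (\<forall>j<p. w (m + j) = w (m + p + j))"
  by (simp add: fold_square_def add_ac)

lemma fold_square_cong:
  assumes "t < p" "fold_square w m t p" "\<And>i. i < 2 * p - t \<Longrightarrow> w (m + i) = w' (m' + i)"
  shows "fold_square w' m' t p"
  unfolding fold_square_def
proof (intro allI impI)
  fix i assume "i < p"
  moreover have "i - t + (t - i) < 2 * p - t" "i + p - t < 2 * p - t"
    using \<open>i < p\<close> assms(1) by arith+
  ultimately show "w' (m' + ((i - t) + (t - i))) = w' (m' + (i + p - t))"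
    using assms(2,3) unfolding fold_square_def by metis
qed

text \<open>For \<open>t < p\<close> the largest index in a folded square is
  \<open>m + (2 * p - t) - 1\<close>, so the bound places the whole square among the first
  \<open>N\<close> letters.\<close>

definition fold_free :: "nat \<Rightarrow> nat \<Rightarrow> (nat \<Rightarrow> 'c) \<Rightarrow> bool" where
  "fold_free k N w \<longleftrightarrow>
    (\<forall>m t p. k \<le> p \<and> t < p \<and> m + (2 * p - t) \<le> N \<longrightarrow> \<not> fold_square w m t p)"

definition ternary_square_free :: "nat \<Rightarrow> (nat \<Rightarrow> nat) \<Rightarrow> bool" where
  "ternary_square_free N w \<longleftrightarrow>
    (\<forall>i<N. w i < 3) \<and> (\<forall>m p. 0 < p \<and> m + 2 * p \<le> N \<longrightarrow> \<not> fold_square w m 0 p)"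

text \<open>
  Tests a predicate at the first \<open>n\<close> ways to split \<open>v\<close> in two. The first part is passed in reverse, so
  that the test of a folded square only compares prefixes of lists.
\<close>

fun scan :: "('a list \<Rightarrow> 'a list \<Rightarrow> 'a list \<Rightarrow> bool) \<Rightarrow> 'a list \<Rightarrow> 'a list \<Rightarrow> 'a list \<Rightarrow> nat \<Rightarrow> bool" where
  "scan P v r (y # d) (Suc n) \<longleftrightarrow> P v r (y # d) \<and> scan P v (y # r) d n"
| "scan P v r _ _ \<longleftrightarrow> True"

lemma scan_split:
  "scan P v (rev (take i v)) (drop i v) n \<longleftrightarrow>
    (\<forall>p. i \<le> p \<and> p < i + n \<and> p < length v \<longrightarrow> P v (rev (take p v)) (drop p v))"
proof (induction n arbitrary: i)
  case (Suc n)
  show ?case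
  proof (cases "i < length v")
    case True
    then have "scan P v (rev (take i v)) (drop i v) (Suc n) \<longleftrightarrow>
        P v (rev (take i v)) (drop i v) \<and> scan P v (rev (take (Suc i) v)) (drop (Suc i) v) n"
      by (simp add: take_Suc_conv_app_nth flip: Cons_nth_drop_Suc)
    with True show ?thesis
      unfolding Suc.IH by (auto simp: Suc_le_eq nat_less_le)
  qed auto
qed auto

lemma scan_iff:
  "scan P v [] v n \<longleftrightarrow> (\<forall>p<n. p < length v \<longrightarrow> P v (rev (take p v)) (drop p v))"
  using scan_split[of P v 0 n] by auto

section \<open>Tests for squares and folded squares at the start of a word\<close>

definition no_square_prefix :: "'a list \<Rightarrow> 'a list \<Rightarrow> 'a list \<Rightarrow> bool" where
  "no_square_prefix v r d \<longleftrightarrow> r = [] \<or> lcp v d < length r"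

lemma no_square_prefix_iff:
  assumes "0 < p" "p < length v"
  shows "no_square_prefix v (rev (take p v)) (drop p v) \<longleftrightarrow>
    \<not> (2 * p \<le> length v \<and> fold_square ((!) v) 0 0 p)"
proof -
  have "p \<le> lcp v (drop p v) \<longleftrightarrow> 2 * p \<le> length v \<and> fold_square ((!) v) 0 0 p"
    unfolding le_lcp_iff fold_square_0 using assms by auto
  then show ?thesis
    unfolding no_square_prefix_def using assms by auto
qed

definition no_fold_prefix :: "nat \<Rightarrow> 'a list \<Rightarrow> 'a list \<Rightarrow> 'a list \<Rightarrow> bool" where
  "no_fold_prefix k v r d \<longleftrightarrow> length r < k \<or> lcp v d + lcp v (hd d # r) \<le> length r"

text \<open>\<open>L\<close> and \<open>M\<close> count the letters on which \<open>v\<close> agrees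
  with itself read forwards and backwards from position \<open>p\<close>. A fold at \<open>t\<close>
  needs \<open>p - t <= L\<close> and \<open>t + 1 <= M\<close>, whence \<open>p < L + M\<close>;
  conversely \<open>t = p - L\<close> works.\<close>

lemma no_fold_prefix_iff:
  assumes "0 < k" "p < length v"
  shows "no_fold_prefix k v (rev (take p v)) (drop p v) \<longleftrightarrow>
    \<not> (k \<le> p \<and> (\<exists>t<p. 2 * p - t \<le> length v \<and> fold_square ((!) v) 0 t p))"
proof -
  define L where "L = lcp v (drop p v)"
  define M where "M = lcp v (hd (drop p v) # rev (take p v))"
  have r: "hd (drop p v) # rev (take p v) = rev (take (Suc p) v)"
    using assms by (simp add: take_Suc_conv_app_nth hd_drop_conv_nth)
  have L: "n \<le> L \<longleftrightarrow> n \<le> length v - p \<and> (\<forall>i<n. v ! i = v ! (p + i))" for n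
    unfolding L_def le_lcp_iff using assms by auto
  have M: "n \<le> M \<longleftrightarrow> n \<le> Suc p \<and> (\<forall>i<n. v ! i = v ! (p - i))" for n
    unfolding M_def r le_lcp_iff using assms by (auto simp: rev_nth)
  have "p < L + M \<longleftrightarrow> (\<exists>t<p. 2 * p - t \<le> length v \<and> fold_square ((!) v) 0 t p)" if "0 < p"
  proof
    assume *: "p < L + M"
    define t where "t = p - L"
    \<comment> \<open>Both comparisons begin with \<open>v ! 0 = v ! p\<close>, so \<open>L\<close>
      and \<open>M\<close> vanish together. This excludes \<open>L = 0\<close>, for which
      \<open>t\<close> would be \<open>p\<close>.\<close>
    have "1 \<le> L \<or> 1 \<le> M" using * by linarith
    then have "v ! 0 = v ! p" unfolding L M by auto
    then have 1: "1 \<le> L" "1 \<le> M" unfolding L M using assms(2) by auto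
    then have "Suc t \<le> M" using * by (auto simp: t_def)
    then have M': "\<forall>j\<le>t. v ! j = v ! (p - j)" unfolding M by auto
    have "t < p" using \<open>0 < p\<close> 1 by (auto simp: t_def)
    moreover have "p - t \<le> L" by (auto simp: t_def)
    then have "p - t \<le> length v - p" "\<forall>i<p - t. v ! i = v ! (p + i)" unfolding L by auto
    ultimately show "\<exists>t<p. 2 * p - t \<le> length v \<and> fold_square ((!) v) 0 t p"
      using M' by (intro exI[of _ t]) (auto simp: fold_square_iff)
  next
    assume "\<exists>t<p. 2 * p - t \<le> length v \<and> fold_square ((!) v) 0 t p"
    then obtain t where t: "t < p" "2 * p - t \<le> length v" "fold_square ((!) v) 0 t p" by blast
    then have "p - t \<le> L" "Suc t \<le> M"
      unfolding L M by (auto simp: fold_square_iff less_Suc_eq_le)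
    with t(1) show "p < L + M" by linarith
  qed
  moreover have "length (rev (take p v)) = p" using assms by simp
  ultimately show ?thesis
    unfolding no_fold_prefix_def L_def[symmetric] M_def[symmetric] using assms(1)
    by (metis gr0I leD leI order_less_le_trans)
qed

text \<open>Words grow at the front, so that a new square starts at the first letter and a test of
  prefixes suffices.\<close>

fun square_free_words :: "nat \<Rightarrow> nat list list" where
  "square_free_words 0 = [[]]"
| "square_free_words (Suc n) =
    filter (\<lambda>v. scan no_square_prefix v [] v (length v))
      (concat (map (\<lambda>x. map (\<lambda>a. a # x) [0, 1, 2]) (square_free_words n)))"

text \<open>By this, a check over a finite list of words holds at every position of a square-free
  sequence.\<close>

lemma square_free_words:
  assumes "ternary_square_free N w" "i + n \<le> N"
  shows "map w [i..<i + n] \<in> set (square_free_words n)"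
  using assms(2)
proof (induction n arbitrary: i)
  case (Suc n)
  let ?v = "map w [i..<i + Suc n]"
  have v: "?v = w i # map w [Suc i..<Suc i + n]"
    by (simp add: upt_conv_Cons del: upt_Suc)
  have cons: "a # x \<in> set (concat (map (\<lambda>x. map (\<lambda>a. a # x) as) xs))"
    if "a \<in> set as" "x \<in> set xs" for a :: nat and x as xs
    using that by auto
  have "w i < 3" using assms(1) Suc.prems by (auto simp: ternary_square_free_def)
  then have "w i \<in> set [0, 1, 2]" by auto
  moreover have "map w [Suc i..<Suc i + n] \<in> set (square_free_words n)"
    using Suc.prems by (intro Suc.IH) simp
  ultimately have 1: "?v \<in> set (concat (map (\<lambda>x. map (\<lambda>a. a # x) [0, 1, 2]) (square_free_words n)))"
    unfolding v by (rule cons)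
  have "scan no_square_prefix ?v [] ?v (length ?v)"
    unfolding scan_iff
  proof (intro allI impI)
    fix p assume p: "p < length ?v"
    show "no_square_prefix ?v (rev (take p ?v)) (drop p ?v)"
    proof (cases "p = 0")
      case False
      have "\<not> (2 * p \<le> length ?v \<and> fold_square ((!) ?v) 0 0 p)"
      proof
        assume *: "2 * p \<le> length ?v \<and> fold_square ((!) ?v) 0 0 p"
        have nth: "?v ! j = w (i + j)" if "j < 2 * p" for j
          using that * by (simp del: upt_Suc)
        have "fold_square w i 0 p"
          using False nth by (intro fold_square_cong[OF _ conjunct2[OF *]]) simp_all
        moreover have "i + 2 * p \<le> N" using * Suc.prems by auto
        ultimately show False using assms(1) False by (auto simp: ternary_square_free_def)
      qed
      then show ?thesis using no_square_prefix_iff[of p ?v] p False by blast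
    qed (auto simp: no_square_prefix_def)
  qed
  with 1 show ?case unfolding square_free_words.simps set_filter mem_Collect_eq by (rule conjI)
qed auto

section \<open>Images of square-free words under uniform morphisms\<close>

text \<open>
  \<open>R\<close> bounds the radius of the palindromes in the image. The images of distinct letters differ
  both in a short prefix and after position \<open>s\<close>, so that a block is recognized even if one of its
  ends is cut off.
\<close>

locale uniform_morphism =
  fixes h :: "nat \<Rightarrow> 'c list" and q R s :: nat
  assumes len: "a < 3 \<Longrightarrow> length (h a) = q"
    and R: "R \<le> s" "s < q" "2 * R < q" "R \<le> 5" "1 < q"
    and suffix: "a < 3 \<Longrightarrow> b < 3 \<Longrightarrow> drop s (h a) = drop s (h b) \<Longrightarrow> a = b"
    and prefix: "a < 3 \<Longrightarrow> b < 3 \<Longrightarrow> take (Suc s - R) (h a) = take (Suc s - R) (h b) \<Longrightarrow> a = b"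
    and sync: "a < 3 \<Longrightarrow> x \<in> set (square_free_words 2) \<Longrightarrow> 0 < r \<Longrightarrow> r < q \<Longrightarrow>
        take q (drop r (concat (map h x))) \<noteq> h a"
begin

definition image :: "(nat \<Rightarrow> nat) \<Rightarrow> nat \<Rightarrow> 'c" where
  "image w n = h (w (n div q)) ! (n mod q)"

lemma image_block: "j < q \<Longrightarrow> image w (q * x + j) = h (w x) ! j"
  by (simp add: image_def)

lemma image_blocks:
  assumes "\<And>i. i < x + l \<Longrightarrow> w i < 3"
  shows "concat (map h (map w [x..<x + l])) = map (image w) [q * x..<q * (x + l)]"
  using assms
proof (induction l)
  case (Suc l)
  have "h (w (x + l)) = map (image w) [q * (x + l)..<q * (x + l) + q]"
    using Suc.prems by (intro nth_equalityI) (auto simp: len image_block)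
  moreover have "[q * x..<q * (x + Suc l)] = [q * x..<q * (x + l)] @ [q * (x + l)..<q * (x + l) + q]"
    using upt_add_eq_append[of "q * x" "q * (x + l)" q] by (simp add: algebra_simps)
  ultimately show ?case
    using Suc by simp
qed simp

lemma drop_image_blocks:
  assumes "\<And>i. i < x + l \<Longrightarrow> w i < 3"
  shows "drop r (concat (map h (map w [x..<x + l]))) = map (image w) [q * x + r..<q * (x + l)]"
  using image_blocks[OF assms] by (simp add: drop_map drop_upt)

text \<open>
  A long repetition synchronizes with the blocks, and then a square of the preimage can be read
  off from the suffixes or the prefixes of the blocks.
\<close>

lemma no_long_repetition:
  assumes w: "ternary_square_free N w" and t: "t \<le> R" "2 * q \<le> Suc (p - t)"
    and N: "m + (2 * p - t) \<le> q * N"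
    and rep: "\<And>j. j < p - t \<Longrightarrow> image w (m + j) = image w (m + p + j)"
  shows False
proof -
  have w3: "i < N \<Longrightarrow> w i < 3" for i using w by (auto simp: ternary_square_free_def)
  have tp: "t < p" "2 * q \<le> Suc p" using t R by auto
  \<comment> \<open>\<open>y\<close> is the first block that starts at or after \<open>m\<close>.
    Since \<open>2 * q <= Suc (p - t)\<close>, it ends within the repeated part.\<close>
  define y where "y = (m + q - 1) div q"
  have y: "m \<le> q * y" "q * y + q \<le> m + 2 * q - 1"
  proof -
    have "q * y + (m + q - 1) mod q = m + q - 1" by (simp add: y_def)
    moreover have "(m + q - 1) mod q < q" using R by simp
    ultimately show "m \<le> q * y" "q * y + q \<le> m + 2 * q - 1" using R by linarith+
  qed
  have ylt: "y < N"
  proof -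
    have "q * y < q * N" using y N t tp R by linarith
    then show ?thesis by simp
  qed
  have per: "image w (q * y + p + j) = h (w y) ! j" if "j < q" for j
    using rep[of "q * y - m + j"] y t that by (simp add: image_block[symmetric] add_ac)
  \<comment> \<open>Otherwise the copy of block \<open>y\<close> at distance \<open>p\<close> would
    lie at a proper offset inside two consecutive blocks, against \<open>sync\<close>.\<close>
  have "q dvd p"
  proof (rule ccontr)
    assume "\<not> q dvd p"
    define r where "r = p mod q"
    define z where "z = y + p div q"
    have r: "0 < r" "r < q" using \<open>\<not> q dvd p\<close> R by (auto simp: r_def dvd_eq_mod_eq_0)
    have zr: "q * y + p = q * z + r" by (simp add: z_def r_def algebra_simps)
    have "q * z + r + q \<le> m + (2 * p - t)" using y(2) t zr tp by linarith
    with N r have "q * (z + 1) < q * N" by (simp add: algebra_simps)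
    then have "z + 1 < N" unfolding mult_less_cancel1 ..
    then have z: "z + 2 \<le> N" by simp
    let ?x = "map w [z..<z + 2]"
    have "take q (drop r (concat (map h ?x))) = h (w y)"
    proof -
      have "drop r (concat (map h ?x)) = map (image w) [q * z + r..<q * (z + 2)]"
        using w3 z by (intro drop_image_blocks) simp
      moreover have "q * z + r + q \<le> q * (z + 2)" using r by (simp add: algebra_simps)
      ultimately have "take q (drop r (concat (map h ?x))) = map (image w) [q * z + r..<q * z + r + q]"
        by (simp add: take_map)
      also have "\<dots> = h (w y)"
        using per w3[OF ylt] by (intro nth_equalityI) (auto simp: len zr)
      finally show ?thesis .
    qed
    with sync[of "w y" ?x r] square_free_words[OF w z] w3[OF ylt] r show False by blast
  qed
  then obtain n where n: "p = q * n" by blast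
  have "2 * q \<le> q * n + 1" using tp n by simp
  have "n \<ge> 2"
  proof (rule ccontr)
    assume "\<not> n \<ge> 2"
    then have "q * n \<le> q * 1" by (intro mult_le_mono2) auto
    with \<open>2 * q \<le> q * n + 1\<close> R show False by simp
  qed
  have square: False if "x + 2 * n \<le> N" "\<And>b. x \<le> b \<Longrightarrow> b < x + n \<Longrightarrow> w b = w (b + n)" for x
  proof -
    have "fold_square w x 0 n"
      unfolding fold_square_0 using that(2)[of "x + j" for j] by (simp add: add_ac)
    then show False using w that(1) \<open>n \<ge> 2\<close> by (auto simp: ternary_square_free_def)
  qed
  have shift: "h (w b) ! j = h (w (b + n)) ! j" if "m \<le> q * b + j" "q * b + j < m + (p - t)" "j < q" for b j
    using rep[of "q * b + j - m"] that image_block[of j w b] image_block[of j w "b + n"]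
    by (simp add: n algebra_simps)
  have pre: "w b = w (b + n)" if "m \<le> q * b" "q * b + (Suc s - R) \<le> m + (p - t)" "b + n < N" for b
  proof (rule prefix)
    show "take (Suc s - R) (h (w b)) = take (Suc s - R) (h (w (b + n)))"
      using that w3 R by (intro nth_equalityI) (auto simp: len intro!: shift)
  qed (use that w3 in auto)
  have suf: "w b = w (b + n)" if "m \<le> q * b + s" "q * b + q \<le> m + (p - t)" "b + n < N" for b
  proof (rule suffix)
    show "drop s (h (w b)) = drop s (h (w (b + n)))"
      using that w3 R by (intro nth_equalityI) (auto simp: len intro!: shift)
  qed (use that w3 in auto)
  define x where "x = m div q"
  define r where "r = m mod q"
  have m: "m = q * x + r" "r < q" using R by (auto simp: x_def r_def)
  have bd: "q * b + q * k \<le> q * c" if "b + k \<le> c" for b k c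
    using mult_le_mono2[OF that, of q] by (simp add: algebra_simps)
  show False
  proof (cases "r \<le> s")
    \<comment> \<open>Block \<open>x\<close> still contains its suffix from \<open>s\<close>, so the
      square of the preimage starts at \<open>x\<close>: the first block is recognized by its
      suffix, the others by their prefixes.\<close>
    case True
    have "q * x + 2 * (q * n) < q * N + q" using N m t R n tp by linarith
    then have "q * (x + 2 * n) < q * (N + 1)" by (simp add: algebra_simps)
    then have "x + 2 * n < N + 1" unfolding mult_less_cancel1 ..
    then have xN: "x + 2 * n \<le> N" by simp
    show False
    proof (rule square[OF xN])
      fix b assume b: "x \<le> b" "b < x + n"
      show "w b = w (b + n)"
      proof (cases "b = x")
        case True
        with \<open>r \<le> s\<close> xN m t \<open>n \<ge> 2\<close> R show ?thesis by (intro suf) auto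
      next
        case False
        have "q * x + q * 1 \<le> q * b" using b False by (intro bd) auto
        moreover have "q * b + q * 1 \<le> q * (x + n)" using b False by (intro bd) auto
        ultimately show ?thesis
          using m t xN b \<open>n \<ge> 2\<close> R n tp by (intro pre) (auto simp: algebra_simps)
      qed
    qed
  next
    \<comment> \<open>Here the square starts one block later. Only \<open>r - t\<close> letters of
      its last block are in the repeated part, but \<open>s < r\<close> and \<open>t <= R\<close>
      leave room for the prefix of length \<open>Suc s - R\<close>.\<close>
    case False
    have "q * x + 2 * (q * n) < q * N" using N m t R n tp False by linarith
    then have "q * (x + 2 * n) < q * N" by (simp add: algebra_simps)
    then have "x + 2 * n < N" unfolding mult_less_cancel1 ..
    then have xN: "Suc x + 2 * n \<le> N" by simp
    show False
    proof (rule square[OF xN])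
      fix b assume b: "Suc x \<le> b" "b < Suc x + n"
      have "q * x + q * 1 \<le> q * b" using b by (intro bd) auto
      moreover have "q * b + q * 0 \<le> q * (x + n)" using b False by (intro bd) auto
      ultimately show "w b = w (b + n)"
        using m t xN b \<open>n \<ge> 2\<close> R n tp False by (intro pre) (auto simp: algebra_simps)
    qed
  qed
qed

text \<open>Reduces short windows of the image at any position to finitely many words and offsets.
  The \<open>l\<close> extra letters of \<open>w\<close> guarantee that \<open>l\<close> whole
  blocks are available from the block of \<open>m\<close> on.\<close>

lemma window:
  assumes "ternary_square_free (N + l) w" "m < q * N" "0 < l"
  obtains x where "x \<in> set (square_free_words l)"
    "drop (m mod q) (concat (map h x)) = map (image w) [m..<m + (q * l - m mod q)]"
proof -
  have "m div q < N" using assms(2) R by (simp add: less_mult_imp_div_less mult.commute)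
  then have "m div q + l \<le> N + l" by simp
  moreover have "drop (m mod q) (concat (map h (map w [m div q..<m div q + l])))
      = map (image w) [q * (m div q) + m mod q..<q * (m div q + l)]"
    using assms(1) calculation by (intro drop_image_blocks) (auto simp: ternary_square_free_def)
  moreover have "q * (m div q) + m mod q = m" by simp
  moreover have "q * (m div q + l) = m + (q * l - m mod q)"
  proof -
    have "m mod q < q" using R by simp
    also have "q \<le> q * l" using assms(3) by simp
    finally have "m mod q \<le> q * l" by simp
    then show ?thesis using \<open>q * (m div q) + m mod q = m\<close> unfolding add_mult_distrib2 by linarith
  qed
  ultimately show thesis
    using that square_free_words[OF assms(1), of "m div q" l] by metis
qed

text \<open>Periods with \<open>2 * q <= Suc p\<close> are excluded by
  \<open>no_long_repetition\<close> without a fold. Otherwise \<open>2 * p <= 4 * q - 4\<close>,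
  which fits into five blocks even after an offset below \<open>q\<close>.\<close>

lemma square_free_image:
  assumes w: "ternary_square_free (N + 5) w"
    and short: "\<And>x r. x \<in> set (square_free_words 5) \<Longrightarrow> r < q \<Longrightarrow>
      (let v = drop r (concat (map h x)) in scan no_square_prefix v [] v (2 * q))"
    and p: "0 < p" "m + 2 * p \<le> q * N"
  shows "\<not> fold_square (image w) m 0 p"
proof
  assume sq: "fold_square (image w) m 0 p"
  show False
  proof (cases "2 * q \<le> Suc p")
    case True
    have "m + (2 * p - 0) \<le> q * (N + 5)" using p by (simp add: add_mult_distrib2)
    with True p sq show False
      by (intro no_long_repetition[OF w, of 0 p m]) (auto simp: fold_square_0)
  next
    case False
    have "m < q * N" using p by simp
    then obtain x where x: "x \<in> set (square_free_words 5)"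
      "drop (m mod q) (concat (map h x)) = map (image w) [m..<m + (q * 5 - m mod q)]"
      using window[OF w] by (metis zero_less_numeral)
    let ?v = "map (image w) [m..<m + (q * 5 - m mod q)]"
    have mq: "m mod q < q" using R by simp
    have "scan no_square_prefix ?v [] ?v (2 * q)"
      using short[OF x(1) mq] by (simp add: Let_def x(2))
    moreover have "2 * p \<le> q * 5 - m mod q" using False mq R by linarith
    then have l: "2 * p \<le> length ?v" by simp
    ultimately have "no_square_prefix ?v (rev (take p ?v)) (drop p ?v)"
      unfolding scan_iff using False p(1) by simp
    moreover have "fold_square ((!) ?v) 0 0 p"
      using p(1) l by (intro fold_square_cong[OF _ sq]) auto
    ultimately show False
      using no_square_prefix_iff[of p ?v] p(1) l by auto
  qed
qed

text \<open>
  A long folded square whose fold is not close to its start contains a palindrome of length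
  \<open>2 * R + 1\<close> or \<open>2 * R + 2\<close>.
\<close>

lemma fold_free_image:
  assumes w: "ternary_square_free (N + 5) w" and k: "0 < k"
    and palindromes: "\<And>x r n. x \<in> set (square_free_words 2) \<Longrightarrow> r < q \<Longrightarrow> n \<in> {2 * R + 1, 2 * R + 2} \<Longrightarrow>
      (let v = take n (drop r (concat (map h x))) in v \<noteq> rev v)"
    and short: "\<And>x r. x \<in> set (square_free_words 5) \<Longrightarrow> r < q \<Longrightarrow>
      (let v = drop r (concat (map h x)) in scan (no_fold_prefix k) v [] v (2 * q - 1 + R))"
  shows "fold_free k (q * N) (image w)"
  unfolding fold_free_def
proof (intro allI impI notI)
  fix m t p assume "k \<le> p \<and> t < p \<and> m + (2 * p - t) \<le> q * N"
  then have p: "k \<le> p" "t < p" "m + (2 * p - t) \<le> q * N" by auto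
  assume sq: "fold_square (image w) m t p"
  have fw: "image w (m + j) = image w (m + p + j)" if "j < p - t" for j
    using sq that p by (auto simp: fold_square_iff)
  have bw: "image w (m + j) = image w (m + p - j)" if "j \<le> t" for j
    using sq that p by (auto simp: fold_square_iff)
  have no_pal: False
    if c: "c + n \<le> q * N" "n \<in> {2 * R + 1, 2 * R + 2}"
      and pal: "\<And>j. j < n \<Longrightarrow> image w (c + j) = image w (c + n - Suc j)" for c n
  proof -
    have "ternary_square_free (N + 2) w" using w by (auto simp: ternary_square_free_def)
    moreover have "c < q * N" using c by auto
    ultimately obtain x where x: "x \<in> set (square_free_words 2)"
      "drop (c mod q) (concat (map h x)) = map (image w) [c..<c + (q * 2 - c mod q)]"
      using window by (metis zero_less_numeral)
    have cq: "c mod q < q" using R by simp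
    have "n \<le> 2 * R + 2" using c(2) by auto
    \<comment> \<open>Here \<open>2 * R < q\<close> gives \<open>n <= q + 1\<close>, so a factor of
      length \<open>n\<close> stays inside two blocks.\<close>
    then have n: "n \<le> q * 2 - c mod q" using R(3) cq by linarith
    have "take n (drop (c mod q) (concat (map h x))) = map (image w) [c..<c + n]"
      unfolding x(2) take_map using n by simp
    moreover have "map (image w) [c..<c + n] = rev (map (image w) [c..<c + n])"
      using pal by (intro nth_equalityI) (auto simp: rev_nth)
    ultimately show False
      using palindromes[OF x(1) cq c(2)] by (simp add: Let_def)
  qed
  show False
  proof (cases "t \<le> R \<and> 2 * q \<le> Suc (p - t)")
    case True
    have "m + (2 * p - t) \<le> q * (N + 5)" using p unfolding add_mult_distrib2 by linarith
    with True p fw show False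
      by (intro no_long_repetition[OF w, of t p m]) auto
  next
    case no_rep: False
    show False
    proof (cases "p < 2 * q - 1 + R")
      case True
      \<comment> \<open>Either \<open>R < t\<close> or \<open>p - t <= 2 * q - 2\<close>; each
        bounds the length of the window.\<close>
      have small: "2 * p - t \<le> 4 * q - 4 + R" using no_rep True p(2) R by linarith
      have "m < q * N" using p by simp
      then obtain x where x: "x \<in> set (square_free_words 5)"
        "drop (m mod q) (concat (map h x)) = map (image w) [m..<m + (q * 5 - m mod q)]"
        using window[OF w] by (metis zero_less_numeral)
      let ?v = "map (image w) [m..<m + (q * 5 - m mod q)]"
      have mq: "m mod q < q" using R by simp
      have "scan (no_fold_prefix k) ?v [] ?v (2 * q - 1 + R)"
        using short[OF x(1) mq] by (simp add: Let_def x(2))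
      \<comment> \<open>The purpose of \<open>R <= 5\<close>: then
        \<open>4 * q - 4 + R <= 4 * q + 1\<close>, and five blocks keep at least
        \<open>4 * q + 1\<close> letters after an offset below \<open>q\<close>.\<close>
      moreover have "2 * p - t \<le> q * 5 - m mod q" using small mq R by linarith
      then have l: "2 * p - t \<le> length ?v" by simp
      moreover have "p < length ?v" using l p(2) by simp
      ultimately have "no_fold_prefix k ?v (rev (take p ?v)) (drop p ?v)"
        unfolding scan_iff using True by blast
      moreover have "fold_square ((!) ?v) 0 t p"
        using p(2) l by (intro fold_square_cong[OF _ sq]) auto
      ultimately show False
        using no_fold_prefix_iff[OF k \<open>p < length ?v\<close>] p l by blast
    next
      case big: False
      then have Rt: "R \<le> t" "4 * R \<le> p" using no_rep R by linarith+
      show False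
      proof (cases "Suc R \<le> p - t")
        case True
        \<comment> \<open>Both comparisons extend over \<open>R\<close> letters on either side of
          \<open>m + p\<close>, which makes them a palindrome centered there.\<close>
        show False
        proof (rule no_pal[of "m + p - R" "2 * R + 1"])
          fix j assume j: "j < 2 * R + 1"
          show "image w (m + p - R + j) = image w (m + p - R + (2 * R + 1) - Suc j)"
          proof (cases "j \<le> R")
            case True
            then show ?thesis
              using bw[of "R - j"] fw[of "R - j"] \<open>Suc R \<le> p - t\<close> Rt by (simp add: algebra_simps)
          next
            case False
            then show ?thesis
              using bw[of "j - R"] fw[of "j - R"] \<open>Suc R \<le> p - t\<close> Rt j by (simp add: algebra_simps)
          qed
        qed (use True p Rt in auto)
      next
        case False
        \<comment> \<open>Now \<open>p - t <= R\<close>, so the backward comparison makes the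
          letters from \<open>m\<close> to \<open>m + p\<close> a palindrome. Its length
          \<open>p + 1\<close> decides by parity which central palindrome is used.\<close>
        show False
        proof (cases "even p")
          case True
          then obtain c where c: "p = 2 * c" by blast
          show False
          proof (rule no_pal[of "m + c - R" "2 * R + 1"])
            fix j assume "j < 2 * R + 1"
            then show "image w (m + c - R + j) = image w (m + c - R + (2 * R + 1) - Suc j)"
              using bw[of "c - R + j"] False Rt c by (simp add: algebra_simps)
          qed (use p c Rt in auto)
        next
          case odd: False
          then obtain c where c: "p = 2 * c + 1" by (metis oddE)
          show False
          proof (rule no_pal[of "m + c - R" "2 * R + 2"])
            fix j assume "j < 2 * R + 2"
            then show "image w (m + c - R + j) = image w (m + c - R + (2 * R + 2) - Suc j)"
              using bw[of "c - R + j"] False Rt c by (simp add: algebra_simps)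
          qed (use p c Rt in auto)
        qed
      qed
    qed
  qed
qed

end

section \<open>Concrete morphisms\<close>

text \<open>The locale assumptions in executable form, on the list of the three blocks; this and the
  next two tests are evaluated by \<open>code_simp\<close>.\<close>

definition morphism_check :: "nat \<Rightarrow> nat \<Rightarrow> 'c list list \<Rightarrow> bool" where
  "morphism_check R s H \<longleftrightarrow>
    (let q = length (hd H) in
      length H = 3 \<and> list_all (\<lambda>u. length u = q) H \<and>
      R \<le> s \<and> s < q \<and> 2 * R < q \<and> R \<le> 5 \<and> 1 < q \<and>
      distinct (map (drop s) H) \<and> distinct (map (take (Suc s - R)) H) \<and>
      list_all (\<lambda>x. let v = concat (map ((!) H) x) in
        list_all (\<lambda>r. take q (drop r v) \<notin> set H) [1..<q]) (square_free_words 2))"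

definition palindrome_check :: "nat \<Rightarrow> 'c list list \<Rightarrow> bool" where
  "palindrome_check R H \<longleftrightarrow>
    list_all (\<lambda>x. let v = concat (map ((!) H) x) in
      list_all (\<lambda>r. list_all (\<lambda>n. let u = take n (drop r v) in u \<noteq> rev u) [2 * R + 1, 2 * R + 2])
        [0..<length (hd H)]) (square_free_words 2)"

definition scan_check ::
    "('c list \<Rightarrow> 'c list \<Rightarrow> 'c list \<Rightarrow> bool) \<Rightarrow> nat \<Rightarrow> 'c list list \<Rightarrow> bool" where
  "scan_check P n H \<longleftrightarrow>
    list_all (\<lambda>x. let v = concat (map ((!) H) x) in
      list_all (\<lambda>r. let u = drop r v in scan P u [] u n) [0..<length (hd H)]) (square_free_words 5)"

lemma uniform_morphismI:
  assumes "morphism_check R s H"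
  shows "uniform_morphism ((!) H) (length (hd H)) R s"
proof
  define q where "q = length (hd H)"
  have H: "length H = 3" "\<And>u. u \<in> set H \<Longrightarrow> length u = q"
    "distinct (map (drop s) H)" "distinct (map (take (Suc s - R)) H)"
    and sync: "\<And>x r. x \<in> set (square_free_words 2) \<Longrightarrow> 0 < r \<Longrightarrow> r < q \<Longrightarrow>
      take q (drop r (concat (map ((!) H) x))) \<notin> set H"
    and R: "R \<le> s" "s < q" "2 * R < q" "R \<le> 5" "1 < q"
    using assms unfolding morphism_check_def q_def[symmetric] Let_def
    by (auto simp: list_all_iff simp del: square_free_words.simps)
  show "R \<le> s" "s < length (hd H)" "2 * R < length (hd H)" "R \<le> 5" "1 < length (hd H)"
    using R unfolding q_def .
  show "length (H ! a) = length (hd H)" if "a < 3" for a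
    using that H unfolding q_def by auto
  show "a = b" if "a < 3" "b < 3" "drop s (H ! a) = drop s (H ! b)" for a b
    using that H(1) nth_eq_iff_index_eq[OF H(3), of a b] by simp
  show "a = b" if "a < 3" "b < 3" "take (Suc s - R) (H ! a) = take (Suc s - R) (H ! b)" for a b
    using that H(1) nth_eq_iff_index_eq[OF H(4), of a b] by simp
  show "take (length (hd H)) (drop r (concat (map ((!) H) x))) \<noteq> H ! a"
    if "a < 3" "x \<in> set (square_free_words 2)" "0 < r" "r < length (hd H)" for a x r
    using sync[OF that(2,3)] that H(1) unfolding q_def by (metis nth_mem)
qed

lemma image_less:
  assumes "morphism_check R s H" "ternary_square_free N w" "i < length (hd H) * N"
    and "list_all (list_all (\<lambda>a. a < c)) H"
  shows "uniform_morphism.image ((!) H) (length (hd H)) w i < c"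
proof -
  interpret uniform_morphism "(!) H" "length (hd H)" R s
    by (rule uniform_morphismI) fact
  have "i div length (hd H) < N" using assms(3) by (simp add: less_mult_imp_div_less mult.commute)
  then have "w (i div length (hd H)) < 3" using assms(2) by (auto simp: ternary_square_free_def)
  moreover have "length H = 3" using assms(1) by (simp add: morphism_check_def Let_def)
  ultimately have "H ! w (i div length (hd H)) \<in> set H" "length (H ! w (i div length (hd H))) = length (hd H)"
    using len by simp_all
  moreover have "0 < length (hd H)" using R by linarith
  then have "i mod length (hd H) < length (hd H)" by simp
  ultimately have "image w i \<in> set (H ! w (i div length (hd H)))"
    unfolding image_def by simp
  then show ?thesis
    using assms(4) \<open>H ! w (i div length (hd H)) \<in> set H\<close> unfolding list_all_iff by blast
qed

text \<open>Leech's square-free morphism.\<close>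

definition leech :: "nat list list" where
  "leech =
    [[0, 1, 2, 1, 0, 2, 1, 2, 0, 1, 2, 1, 0],
     [1, 2, 0, 2, 1, 0, 2, 0, 1, 2, 0, 2, 1],
     [2, 0, 1, 0, 2, 1, 0, 1, 2, 0, 1, 0, 2]]"

text \<open>Without folds \<open>R = 0\<close> is enough, and for \<open>s = 0\<close> the blocks
  are told apart by their first letters. The bound 26 is twice the block length.\<close>

lemma leech_checks:
  "morphism_check 0 0 leech" "scan_check no_square_prefix 26 leech" "list_all (list_all (\<lambda>a. a < 3)) leech"
  by code_simp+

lemma ternary_square_free_mono:
  "ternary_square_free N w \<Longrightarrow> M \<le> N \<Longrightarrow> ternary_square_free M w"
  unfolding ternary_square_free_def by (meson less_le_trans le_trans)

text \<open>Iterating Leech's morphism: a word of length \<open>n + 5\<close> yields one of length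
  \<open>13 * n\<close>, which is longer as soon as \<open>1 <= n\<close>. One explicit word of
  length 6 starts the iteration.\<close>

lemma ternary_square_free_exists: "\<exists>w. ternary_square_free N w"
proof (induction N)
  case (Suc N)
  show ?case
  proof (cases "N < 6")
    case True
    define u :: "nat list" where "u = [0, 1, 0, 2, 0, 1]"
    have "list_all (\<lambda>m. list_all (\<lambda>p. 0 < p \<and> m + 2 * p \<le> 6 \<longrightarrow>
        list_ex (\<lambda>j. u ! (m + j) \<noteq> u ! (m + p + j)) [0..<p]) [0..<4]) [0..<6]"
      unfolding u_def by code_simp
    then have *: "\<exists>j<p. u ! (m + j) \<noteq> u ! (m + p + j)"
      if "m < 6" "p < 4" "0 < p" "m + 2 * p \<le> 6" for m p
      using that unfolding list_all_iff list_ex_iff set_upt by (meson atLeastLessThan_iff le0)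
    have "\<not> fold_square ((!) u) m 0 p" if "0 < p" "m + 2 * p \<le> 6" for m p
      unfolding fold_square_0 using *[of m p] that by auto
    moreover have "length u = 6" "set u \<subseteq> {..<3}" by (auto simp: u_def)
    then have "u ! i < 3" if "i < 6" for i
      using that by (metis lessThan_iff nth_mem subsetD)
    ultimately have "ternary_square_free (Suc N) ((!) u)"
      using True unfolding ternary_square_free_def by (meson Suc_leI le_trans less_le_trans)
    then show ?thesis by blast
  next
    case False
    then obtain n where n: "N = n + 5" "1 \<le> n" 
      by (intro that[of "N - 5"]) auto
    from Suc obtain w where w: "ternary_square_free (n + 5) w" unfolding n ..
    interpret uniform_morphism "(!) leech" "length (hd leech)" 0 0
      by (rule uniform_morphismI) (rule leech_checks)
    have q: "length (hd leech) = 13" by (simp add: leech_def)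
    have "ternary_square_free (13 * n) (image w)"
      unfolding ternary_square_free_def
    proof (intro conjI allI impI)
      show "image w i < 3" if "i < 13 * n" for i
        using image_less[OF leech_checks(1) w _ leech_checks(3), of i] that q by simp
      show "\<not> fold_square (image w) m 0 p" if "0 < p \<and> m + 2 * p \<le> 13 * n" for m p
        using that leech_checks(2) 
        by (intro square_free_image[OF w]) (auto simp: scan_check_def list_all_iff q Let_def)
    qed
    moreover have "Suc N \<le> 13 * n" using n by simp
    ultimately show ?thesis using ternary_square_free_mono by blast
  qed
qed (simp add: ternary_square_free_def)

lemma fold_free_exists:
  assumes "morphism_check R s H" "palindrome_check R H"
    and "scan_check (no_fold_prefix k) (2 * length (hd H) - 1 + R) H"
    and "list_all (list_all (\<lambda>a. a < c)) H" "0 < k"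
  shows "\<exists>w. fold_free k N w \<and> (\<forall>i<N. w i < c)"
proof -
  interpret uniform_morphism "(!) H" "length (hd H)" R s
    by (rule uniform_morphismI) fact
  obtain w where w: "ternary_square_free (N + 5) w" using ternary_square_free_exists by blast
  have *: "N \<le> length (hd H) * N" using R by simp
  have "fold_free k (length (hd H) * N) (image w)"
    using assms(2,3) by (intro fold_free_image[OF w \<open>0 < k\<close>])
      (auto simp: palindrome_check_def scan_check_def list_all_iff Let_def)
  with * have "fold_free k N (image w)" unfolding fold_free_def by (meson le_trans)
  moreover have "image w i < c" if "i < N" for i
  proof (rule image_less[OF assms(1) w _ assms(4)])
    show "i < length (hd H) * (N + 5)" using that * unfolding add_mult_distrib2 by linarith
  qed
  ultimately show ?thesis by blast
qed

text \<open>The letter 3 marks the ends of the blocks, and the blocks differ in their first letter,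
  all that \<open>R = s = 1\<close> leaves of the prefix.\<close>

lemma fold_free_4: "\<exists>w. fold_free 1 N w \<and> (\<forall>i<N. w i < (4 :: nat))"
  by (rule fold_free_exists[of 1 1 "[[0, 2, 1, 0, 3], [1, 2, 0, 1, 3], [2, 0, 1, 2, 3]]"]; code_simp)

text \<open>The blocks are shifts of one another modulo 3. Doubled letters are allowed for
  \<open>k = 2\<close>; besides single letters they are the only palindromes in the images.\<close>

lemma fold_free_3: "\<exists>w. fold_free 2 N w \<and> (\<forall>i<N. w i < (3 :: nat))"
  by (rule fold_free_exists[of 1 1
      "[[0, 1, 2, 2, 0, 1, 1, 2, 2, 0, 0, 1],
        [1, 2, 0, 0, 1, 2, 2, 0, 0, 1, 1, 2],
        [2, 0, 1, 1, 2, 0, 0, 1, 1, 2, 2, 0]]"]; code_simp)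

text \<open>The palindrome 0 1 0 1 0 occurs, so that a radius \<open>R = 3\<close> is used. Two
  blocks first differ in their fourth letter, which requires \<open>Suc s - R = 4\<close>.\<close>

lemma fold_free_2: "\<exists>w. fold_free 5 N w \<and> (\<forall>i<N. w i < (2 :: nat))"
  by (rule fold_free_exists[of 3 6
      "[[0, 1, 1, 1, 0, 0, 1, 0, 1, 0, 1, 1, 0, 0, 0, 1, 0, 0, 1, 1],
        [1, 0, 1, 0, 0, 0, 1, 1, 0, 1, 1, 1, 0, 0, 0, 1, 0, 0, 1, 1],
        [1, 0, 1, 1, 0, 0, 1, 0, 0, 0, 1, 1, 0, 1, 0, 1, 0, 0, 1, 1]]"]; code_simp)

section \<open>Backtracking\<close>

text \<open>The search extends words to the left. A folded square has its fold at its leftmost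
  position, so one created by a new letter is found by the test of prefixes.\<close>

fun doomed :: "nat \<Rightarrow> nat \<Rightarrow> nat \<Rightarrow> nat list \<Rightarrow> bool" where
  "doomed c k 0 v \<longleftrightarrow> \<not> scan (no_fold_prefix k) v [] v (length v)"
| "doomed c k (Suc n) v \<longleftrightarrow> \<not> scan (no_fold_prefix k) v [] v (length v) \<or>
    list_all (\<lambda>a. doomed c k n (a # v)) [0..<c]"

lemma not_scan_fold_free:
  assumes "\<not> scan (no_fold_prefix k) v [] v (length v)" "0 < k"
  shows "\<not> fold_free k (length (x @ v)) ((!) (x @ v))"
proof -
  obtain p where "p < length v" "\<not> no_fold_prefix k v (rev (take p v)) (drop p v)"
    using assms(1) unfolding scan_iff by blast
  then obtain t where t: "k \<le> p" "t < p" "2 * p - t \<le> length v" "fold_square ((!) v) 0 t p"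
    using no_fold_prefix_iff assms(2) by blast
  have "fold_square ((!) (x @ v)) (length x) t p"
    by (rule fold_square_cong[OF t(2,4)]) simp
  moreover have "length x + (2 * p - t) \<le> length (x @ v)" using t by simp
  ultimately show ?thesis using t unfolding fold_free_def by blast
qed

lemma doomed_not_fold_free:
  assumes "doomed c k n v" "0 < k" "set x \<subseteq> {..<c}" "length x = n"
  shows "\<not> fold_free k (length (x @ v)) ((!) (x @ v))"
  using assms(1,3,4)
proof (induction n arbitrary: x v)
  case 0
  then show ?case using not_scan_fold_free[OF _ assms(2), of v "[]"] by simp
next
  case (Suc n)
  show ?case
  proof (cases "scan (no_fold_prefix k) v [] v (length v)")
    case False
    then show ?thesis by (rule not_scan_fold_free[OF _ assms(2)])
  next
    case True
    \<comment> \<open>The search reads \<open>x\<close> from its end: the last letter is the next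
      one put in front of \<open>v\<close>.\<close>
    obtain y a where x: "x = y @ [a]" using Suc.prems(3) by (metis length_0_conv nat.simps(3) rev_exhaust)
    then have "doomed c k n (a # v)" using Suc.prems True by (auto simp: list_all_iff)
    then show ?thesis using Suc.IH[of "a # v" y] Suc.prems x by simp
  qed
qed

lemma not_fold_free_ternary: 
  assumes "set x \<subseteq> {..<3 :: nat}" "length x = 6"
  shows "\<not> fold_free 1 6 ((!) x)"
proof -
  have "doomed 3 1 6 []" by code_simp
  from doomed_not_fold_free[OF this _ assms] assms(2) show ?thesis by simp
qed

lemma not_fold_free_binary: 
  assumes "set x \<subseteq> {..<2 :: nat}" "length x = 15"
  shows "\<not> fold_free 4 15 ((!) x)"
proof -
  have "doomed 2 4 15 []" by code_simp
  from doomed_not_fold_free[OF this _ assms] assms(2) show ?thesis by simp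
qed

lemma not_fold_free_unary: 
  assumes "set x \<subseteq> {..<1 :: nat}" "length x = 2 * k" "0 < k"
  shows "\<not> fold_free k (2 * k) ((!) x)"
proof -
  have "x ! i = 0" if "i < 2 * k" for i using assms that by (metis lessThan_iff less_one nth_mem subsetD)
  then have "fold_square ((!) x) 0 0 k" unfolding fold_square_0 by simp
  with assms(3) show ?thesis unfolding fold_free_def by fastforce
qed

section \<open>Coloring trees by depth\<close>

lemma vpath_with_proj_iff:
  "vpath vs (with_proj G) \<longleftrightarrow>
    vs \<noteq> [] \<and> set vs \<subseteq> pverts G \<and> distinct vs \<and> successively (\<lambda>u v. (u, v) \<in> parcs G) vs"
proof -
  have "set (vwalk_arcs vs) \<subseteq> parcs G \<longleftrightarrow> successively (\<lambda>u v. (u, v) \<in> parcs G) vs"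
    by (induction vs rule: vwalk_arcs.induct) auto
  then show ?thesis by (auto simp: vpath_def vwalk_def)
qed

section \<open>Depth and parent functions\<close>

definition rooting :: "'a pair_pre_digraph \<Rightarrow> ('a \<Rightarrow> nat) \<Rightarrow> ('a \<Rightarrow> 'a) \<Rightarrow> bool" where
  "rooting G d par \<longleftrightarrow>
    (\<forall>u v. (u, v) \<in> parcs G \<longrightarrow> v = par u \<and> d u = Suc (d v) \<or> u = par v \<and> d v = Suc (d u))"

text \<open>A step to the parent would go below the minimal depth at the start, and later it would
  return to the previous vertex, since the parent is unique.\<close>

lemma rooting_ascending:
  assumes "rooting G d par" "distinct xs" "successively (\<lambda>u v. (u, v) \<in> parcs G) xs"
    and "\<forall>x\<in>set xs. d (xs ! 0) \<le> d x" "i < length xs"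
  shows "d (xs ! i) = d (xs ! 0) + i \<and> (0 < i \<longrightarrow> par (xs ! i) = xs ! (i - 1))"
  using assms(5)
proof (induction i)
  case (Suc i)
  then have IH: "d (xs ! i) = d (xs ! 0) + i" "0 < i \<longrightarrow> par (xs ! i) = xs ! (i - 1)" by auto
  have "(xs ! i, xs ! Suc i) \<in> parcs G"
    using successively_nth[OF assms(3)] Suc.prems by blast
  then consider "xs ! Suc i = par (xs ! i)" "d (xs ! i) = Suc (d (xs ! Suc i))"
    | "xs ! i = par (xs ! Suc i)" "d (xs ! Suc i) = Suc (d (xs ! i))"
    using assms(1) unfolding rooting_def by blast
  then show ?case
  proof cases
    case 1
    have "d (xs ! 0) \<le> d (xs ! Suc i)" using assms(4) Suc.prems by simp
    with 1 IH have "0 < i" by linarith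
    with 1 IH have "xs ! Suc i = xs ! (i - 1)" by simp
    moreover have "i - 1 < length xs" using Suc.prems by linarith
    ultimately show ?thesis
      using Suc.prems nth_eq_iff_index_eq[OF assms(2), of "Suc i" "i - 1"] by simp
  qed (use IH in auto)
qed simp

text \<open>Both halves of the path, read from a vertex of minimal depth, ascend. The parents of the
  two ends serve to exclude cycles.\<close>

lemma rooting_vpath:
  assumes G: "rooting G d par" "symmetric (with_proj G)" and vs: "vpath vs (with_proj G)"
  obtains t where "t < length vs"
    and "\<And>i. i < length vs \<Longrightarrow> d (vs ! i) = d (vs ! t) + ((i - t) + (t - i))"
    and "t < length vs - 1 \<Longrightarrow> par (vs ! (length vs - 1)) = vs ! (length vs - 2)"
    and "0 < t \<Longrightarrow> par (vs ! 0) = vs ! 1"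
proof -
  let ?E = "\<lambda>u v. (u, v) \<in> parcs G"
  have vs': "vs \<noteq> []" "distinct vs" "successively ?E vs"
    using vs unfolding vpath_with_proj_iff by auto
  have sym: "?E u v \<Longrightarrow> ?E v u" for u v
    using G(2) by (auto simp: symmetric_def sym_def)
  obtain t where t: "t < length vs" "\<And>i. i < length vs \<Longrightarrow> d (vs ! t) \<le> d (vs ! i)"
    using ex_has_least_nat[of "\<lambda>i. i < length vs" 0 "\<lambda>i. d (vs ! i)"] vs'(1) by auto
  have up: "d (drop t vs ! i) = d (drop t vs ! 0) + i \<and>
      (0 < i \<longrightarrow> par (drop t vs ! i) = drop t vs ! (i - 1))" if "i < length (drop t vs)" for i
  proof (rule rooting_ascending[OF G(1) _ _ _ that])
    show "successively ?E (drop t vs)"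
      using vs'(3) by (metis append_take_drop_id successively_append_iff)
    show "\<forall>x\<in>set (drop t vs). d (drop t vs ! 0) \<le> d x"
      using t by (auto simp: in_set_conv_nth)
  qed (use vs' in auto)
  let ?r = "rev (take (Suc t) vs)"
  have down: "d (?r ! i) = d (?r ! 0) + i \<and> (0 < i \<longrightarrow> par (?r ! i) = ?r ! (i - 1))"
    if "i < length ?r" for i
  proof (rule rooting_ascending[OF G(1) _ _ _ that])
    have "successively ?E (take (Suc t) vs)"
      using vs'(3) by (metis append_take_drop_id successively_append_iff)
    then show "successively ?E ?r"
      using sym by (auto elim: successively_mono)
    show "\<forall>x\<in>set ?r. d (?r ! 0) \<le> d x"
      using t by (auto simp: in_set_conv_nth rev_nth)
  qed (use vs' in auto)
  show thesis
  proof
    show "t < length vs" by fact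
    show "d (vs ! i) = d (vs ! t) + ((i - t) + (t - i))" if "i < length vs" for i
    proof (cases "i < t")
      case True
      with down[of "t - i"] t(1) show ?thesis by (simp add: rev_nth)
    next
      case False
      with up[of "i - t"] t(1) that show ?thesis by simp
    qed
    show "par (vs ! (length vs - 1)) = vs ! (length vs - 2)" if "t < length vs - 1"
      using up[of "length vs - 1 - t"] that by (simp add: numeral_2_eq_2)
    show "par (vs ! 0) = vs ! 1" if "0 < t"
      using down[of t] t(1) that by (simp add: rev_nth)
  qed
qed

text \<open>The edge closing a cycle leads from one end of the path to its parent. That parent is
  also the neighbor of this end on the path, against distinctness.\<close>

lemma rooting_acyclic:
  assumes G: "rooting G d par" "symmetric (with_proj G)"
  shows "\<not> has_cycle G"
proof
  assume "has_cycle G"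
  then obtain vs where vs: "vpath vs (with_proj G)" "3 \<le> length vs" "(last vs, hd vs) \<in> parcs G"
    unfolding has_cycle_def by blast
  let ?n = "length vs"
  have d: "distinct vs" "vs \<noteq> []" using vs(1) by (auto simp: vpath_with_proj_iff)
  have hl: "hd vs = vs ! 0" "last vs = vs ! (?n - 1)" using d(2) by (simp_all add: hd_conv_nth last_conv_nth)
  obtain t where t: "t < ?n" "\<And>i. i < ?n \<Longrightarrow> d (vs ! i) = d (vs ! t) + ((i - t) + (t - i))"
    "t < ?n - 1 \<Longrightarrow> par (vs ! (?n - 1)) = vs ! (?n - 2)" "0 < t \<Longrightarrow> par (vs ! 0) = vs ! 1"
    using rooting_vpath[OF G vs(1)] by blast
  have d0: "d (vs ! 0) = d (vs ! t) + t" "d (vs ! (?n - 1)) = d (vs ! t) + (?n - 1 - t)"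
    using t(1) t(2)[of 0] t(2)[of "?n - 1"] d(2) by auto
  have neq: "vs ! 0 \<noteq> vs ! (?n - 2)" "vs ! (?n - 1) \<noteq> vs ! 1"
    using vs(2) d(2) nth_eq_iff_index_eq[OF d(1), of 0 "?n - 2"] nth_eq_iff_index_eq[OF d(1), of "?n - 1" 1]
    by auto
  from vs(3) consider "hd vs = par (last vs)" "d (last vs) = Suc (d (hd vs))"
    | "last vs = par (hd vs)" "d (hd vs) = Suc (d (last vs))"
    using G(1) unfolding rooting_def by blast
  then show False
  proof cases
    case 1
    then have "t < ?n - 1" using d0 unfolding hl by linarith
    with 1 t(3) neq show False unfolding hl by simp
  next
    case 2
    then have "0 < t" using d0 unfolding hl by linarith
    with 2 t(4) neq show False unfolding hl by simp
  qed
qed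

text \<open>Common first vertices are removed by induction. Where the paths diverge, following one
  until it first meets the other closes a cycle.\<close>

lemma unique_vpath:
  assumes "\<not> has_cycle G" "symmetric (with_proj G)"
    and "vpath p (with_proj G)" "vpath q (with_proj G)" "hd p = hd q" "last p = last q"
  shows "p = q"
  using assms(3-6)
proof (induction p arbitrary: q)
  case (Cons a p)
  let ?E = "\<lambda>u v. (u, v) \<in> parcs G"
  have sym: "?E u v \<Longrightarrow> ?E v u" for u v
    using assms(2) by (auto simp: symmetric_def sym_def)
  obtain q' where q: "q = a # q'"
    using Cons.prems by (cases q) (auto simp: vpath_with_proj_iff)
  have P: "set (a # p) \<subseteq> pverts G" "distinct (a # p)" "successively ?E (a # p)"
    and Q: "set (a # q') \<subseteq> pverts G" "distinct (a # q')" "successively ?E (a # q')"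
    using Cons.prems(1,2) unfolding vpath_with_proj_iff q by auto
  show ?case
  proof (cases "p = [] \<or> q' = []")
    case True
    then show ?thesis using Cons.prems(4) P(2) Q(2) unfolding q
      by (metis distinct.simps(2) last.simps last_in_set)
  next
    case False
    then have ne: "p \<noteq> []" "q' \<noteq> []" by auto
    have pv: "vpath p (with_proj G)" "vpath q' (with_proj G)"
      using P Q ne by (auto simp: vpath_with_proj_iff successively_Cons)
    have last: "last p = last q'" using Cons.prems(4) ne unfolding q by simp
    show ?thesis
    proof (cases "hd p = hd q'")
      case True
      then show ?thesis using Cons.IH[OF pv True last] q by simp
    next
      case neq: False
      have "\<exists>z\<in>set p. z \<in> set q'" using last ne last_in_set by metis
      then obtain p1 z p2 where p: "p = p1 @ z # p2" "z \<in> set q'" "\<forall>y\<in>set p1. y \<notin> set q'"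
        using split_list_first_prop[of p "\<lambda>z. z \<in> set q'"] by blast
      obtain q1 q2 where q': "q' = q1 @ z # q2" using p(2) by (meson split_list)
      \<comment> \<open>The cycle runs along \<open>p\<close> to \<open>z\<close> and back along
        \<open>q'\<close>; \<open>hd p\<close> and \<open>hd q'\<close> differ, so it has at least
        three vertices.\<close>
      let ?c = "a # p1 @ z # rev q1"
      have "successively ?E (a # p1 @ [z])"
        using P(3) unfolding p(1) by (auto simp: successively_append_iff successively_Cons hd_append split: if_splits)
      moreover have "successively ?E (z # rev q1)"
      proof -
        have "successively ?E (rev (z # rev q1))"
          using Q(3) unfolding q' by (auto simp: successively_append_iff successively_Cons)
        then show ?thesis unfolding successively_rev using sym by (auto elim!: successively_mono)
      qed
      ultimately have "successively ?E ?c"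
        by (auto simp: successively_append_iff successively_Cons hd_append split: if_splits)
      then have "vpath ?c (with_proj G)"
        using P(1,2) Q(1,2) p(3) unfolding vpath_with_proj_iff p(1) q' by auto
      moreover have "last ?c = hd q'" unfolding q' by (cases q1) auto
      then have "(last ?c, hd ?c) \<in> parcs G"
        using Q(3) ne sym by (auto simp: successively_Cons)
      moreover have "3 \<le> length ?c"
        using neq unfolding p(1) q' by (cases p1; cases q1) auto
      ultimately show ?thesis
        using assms(1) unfolding has_cycle_def by blast
    qed
  qed
qed (auto simp: vpath_with_proj_iff)

text \<open>The depth is the length of the unique path from a root \<open>r\<close>, and the parent
  is the vertex before the last on it.\<close>

lemma tree_rooting:
  assumes "G \<in> trees"
  obtains d par where "rooting G d par"
proof -
  have G: "pair_graph G" "Digraph_Component.connected (with_proj G)" "\<not> has_cycle G"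
    using assms by (auto simp: trees_def)
  interpret pair_graph G by (rule G)
  have sym: "symmetric (with_proj G)" by (rule pair_sym_arcs)
  have "strongly_connected (with_proj G)"
    by (rule symmetric_connected_imp_strongly_connected[OF sym G(2)])
  then obtain r where r: "r \<in> pverts G"
    and reach: "\<And>v. v \<in> pverts G \<Longrightarrow> r \<rightarrow>\<^sup>*\<^bsub>with_proj G\<^esub> v"
    by (auto simp: strongly_connected_def)
  define P where "P v = (SOME p. vpath p (with_proj G) \<and> hd p = r \<and> last p = v)" for v
  have P: "vpath (P v) (with_proj G)" "hd (P v) = r" "last (P v) = v" if "v \<in> pverts G" for v
    using someI_ex[OF reach[OF that, unfolded reachable_vpath_conv]] unfolding P_def by blast+
  have eq: "P v = p" if "vpath p (with_proj G)" "hd p = r" "last p = v" for p v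
  proof (rule unique_vpath[OF G(3) sym])
    have "v \<in> pverts G" using that by (auto simp: vpath_with_proj_iff)
    then show "vpath (P v) (with_proj G)" "hd (P v) = hd p" "last (P v) = last p"
      using P that by simp_all
  qed (use that in simp)
  \<comment> \<open>If \<open>v\<close> lies on \<open>P u\<close>, uniqueness makes the rest of
    \<open>P u\<close> the single edge; otherwise the edge extends \<open>P u\<close>.\<close>
  have step: "P u = P v @ [u] \<or> P v = P u @ [v]" if uv: "(u, v) \<in> parcs G" for u v
  proof -
    have V: "u \<in> pverts G" "v \<in> pverts G" using uv by (auto simp: in_arcsD1 in_arcsD2)
    have "u \<noteq> v" using uv by (rule no_loops')
    have vu: "(v, u) \<in> parcs G" using uv sym by (auto simp: symmetric_def sym_def)
    note Pu = P(1)[OF V(1), unfolded vpath_with_proj_iff]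
    show ?thesis
    proof (cases "v \<in> set (P u)")
      case True
      then obtain p1 p2 where p: "P u = p1 @ v # p2" by (meson split_list)
      have "vpath (p1 @ [v]) (with_proj G)"
        using Pu unfolding p vpath_with_proj_iff
        by (auto simp: successively_append_iff successively_Cons)
      moreover have "hd (p1 @ [v]) = r" using P(2)[OF V(1)] unfolding p by (cases p1) auto
      ultimately have "P v = p1 @ [v]" by (intro eq) auto
      moreover have "v # p2 = [v, u]"
      proof (rule unique_vpath[OF G(3) sym])
        show "vpath (v # p2) (with_proj G)"
          using Pu unfolding p vpath_with_proj_iff by (auto simp: successively_append_iff)
        show "vpath [v, u] (with_proj G)"
          using V vu \<open>u \<noteq> v\<close> by (auto simp: vpath_with_proj_iff)
        show "last (v # p2) = last [v, u]" using P(3)[OF V(1)] unfolding p by simp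
      qed simp
      ultimately show ?thesis using p by simp
    next
      case False
      have "vpath (P u @ [v]) (with_proj G)"
        using Pu False V uv P(3)[OF V(1)] by (auto simp: vpath_with_proj_iff successively_append_iff)
      moreover have "hd (P u @ [v]) = r" using Pu P(2)[OF V(1)] by (cases "P u") auto
      ultimately have "P v = P u @ [v]" by (intro eq) auto
      then show ?thesis ..
    qed
  qed
  have "rooting G (\<lambda>v. length (P v)) (\<lambda>v. last (butlast (P v)))"
    unfolding rooting_def
  proof (intro allI impI)
    fix u v assume uv: "(u, v) \<in> parcs G"
    then have "last (P u) = u" "last (P v) = v" using P(3) by (auto simp: in_arcsD1 in_arcsD2)
    with step[OF uv] show "v = last (butlast (P u)) \<and> length (P u) = Suc (length (P v)) \<or>
        u = last (butlast (P v)) \<and> length (P v) = Suc (length (P u))"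
      by auto
  qed
  then show thesis by (rule that)
qed

text \<open>The coloring is \<open>w\<close> applied to the depth. A square on a path gives a folded
  square of \<open>w\<close> below the maximal depth.\<close>

lemma trees_avoiding_colorable:
  assumes "G \<in> trees" "0 < k" and w: "\<And>N. \<exists>w. fold_free k N w \<and> (\<forall>i<N. w i < c)"
  shows "avoiding_colorable k G c"
proof -
  obtain d par where rooting: "rooting G d par" using tree_rooting assms(1) by blast
  interpret pair_graph G using assms(1) by (simp add: trees_def)
  define N where "N = Suc (Max (d ` pverts G))"
  have N: "d v < N" if "v \<in> pverts G" for v
    using that pair_finite_verts by (auto simp: N_def less_Suc_eq_le)
  obtain w where w: "fold_free k N w" "\<forall>i<N. w i < c" using w by blast
  have "\<not> contains_square G (w \<circ> d) p" if "k \<le> p" for p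
  proof
    assume "contains_square G (w \<circ> d) p"
    then obtain vs u where vs: "vpath vs (with_proj G)" and u: "length u = p" "map (w \<circ> d) vs = u @ u"
      unfolding contains_square_def square_word_def by blast
    have len: "length vs = 2 * p" using arg_cong[OF u(2), of length] u(1) by simp
    have sq: "w (d (vs ! i)) = w (d (vs ! (i + p)))" if "i < p" for i
    proof -
      have "map (w \<circ> d) vs ! i = map (w \<circ> d) vs ! (i + p)"
        unfolding u(2) using that u(1) by (simp add: nth_append)
      then show ?thesis using that len by simp
    qed
    obtain t where t: "t < 2 * p"
      "\<And>i. i < 2 * p \<Longrightarrow> d (vs ! i) = d (vs ! t) + ((i - t) + (t - i))"
      using rooting_vpath[OF rooting pair_sym_arcs vs] len by metis
    have dN: "d (vs ! i) < N" if "i < 2 * p" for i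
    proof -
      have "vs ! i \<in> pverts G"
        using that len vs nth_mem[of i vs] unfolding vpath_with_proj_iff by auto
      then show ?thesis by (rule N)
    qed
    show False
    proof (cases "t < p")
      case True
      have "fold_square w (d (vs ! t)) t p"
        unfolding fold_square_def
      proof (intro allI impI)
        fix i assume "i < p"
        then show "w (d (vs ! t) + ((i - t) + (t - i))) = w (d (vs ! t) + (i + p - t))"
          using sq[of i] t(2)[of i] t(2)[of "i + p"] True by simp
      qed
      moreover have "d (vs ! t) + (2 * p - t) \<le> N"
        using dN[of "2 * p - 1"] t(2)[of "2 * p - 1"] True by simp
      ultimately show False using w(1) \<open>k \<le> p\<close> True by (auto simp: fold_free_def)
    next
      case False
      \<comment> \<open>The fold lies in the second half. Reversing the path sends index
        \<open>t\<close> to \<open>2 * p - 1 - t\<close>, in the first half.\<close>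
      define s where "s = 2 * p - 1 - t"
      have s: "s < p" "t = 2 * p - 1 - s" using t(1) False by (auto simp: s_def)
      have "fold_square w (d (vs ! t)) s p"
        unfolding fold_square_def
      proof (intro allI impI)
        fix i assume i: "i < p"
        have "(p - 1 - i + p - t) + (t - (p - 1 - i + p)) = (i - s) + (s - i)"
          "(p - 1 - i - t) + (t - (p - 1 - i)) = i + p - s"
          using i s by arith+
        moreover have "p - 1 - i < 2 * p" "p - 1 - i + p < 2 * p" "p - 1 - i < p" using i by linarith+
        ultimately show "w (d (vs ! t) + ((i - s) + (s - i))) = w (d (vs ! t) + (i + p - s))"
          using sq[of "p - 1 - i"] t(2)[of "p - 1 - i"] t(2)[of "p - 1 - i + p"] by metis
      qed
      moreover have "d (vs ! t) + (2 * p - s) \<le> N"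
        using dN[of 0] t(2)[of 0] s by simp
      ultimately show False using w(1) \<open>k \<le> p\<close> s by (auto simp: fold_free_def)
    qed
  qed
  moreover have "(w \<circ> d) ` pverts G \<subseteq> {..<c}" using w(2) N by auto
  ultimately show ?thesis unfolding avoiding_colorable_def by blast
qed

section \<open>Complete trees\<close>

definition bounded_lists :: "nat \<Rightarrow> nat \<Rightarrow> nat list set" where
  "bounded_lists b n = {xs. set xs \<subseteq> {..<b} \<and> length xs < n}"

lemma finite_bounded_lists: "finite (bounded_lists b n)"
  by (rule finite_subset[OF _ finite_lists_length_le[of "{..<b}" n]]) (auto simp: bounded_lists_def)

text \<open>
  Its nodes are lists, and the children of \<open>xs\<close> are the lists \<open>i # xs\<close>; \<open>f\<close> embeds them into the
  given vertex type.
\<close>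

definition complete_tree :: "(nat list \<Rightarrow> 'a) \<Rightarrow> nat \<Rightarrow> nat \<Rightarrow> 'a pair_pre_digraph" where
  "complete_tree f b n = \<lparr>pverts = f ` bounded_lists b n,
    parcs = {(f xs, f (i # xs)) |xs i. i # xs \<in> bounded_lists b n} \<union>
      {(f (i # xs), f xs) |xs i. i # xs \<in> bounded_lists b n}\<rparr>"

lemma bounded_lists_Cons: "i # xs \<in> bounded_lists b n \<Longrightarrow> xs \<in> bounded_lists b n"
  by (auto simp: bounded_lists_def)

text \<open>Every node is reached from \<open>f []\<close>, and length and \<open>tl\<close>,
  transported along \<open>f\<close>, form a rooting, which excludes cycles.\<close>

lemma complete_tree_in_trees:
  assumes f: "inj_on f (bounded_lists b n)" and n: "0 < n"
  shows "complete_tree f b n \<in> trees"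
proof -
  let ?G = "complete_tree f b n" and ?B = "bounded_lists b n"
  have eq: "f xs = f ys \<longleftrightarrow> xs = ys" if "xs \<in> ?B" "ys \<in> ?B" for xs ys
    using f that by (auto simp: inj_on_def)
  have V: "pverts ?G = f ` ?B" by (simp add: complete_tree_def)
  have A: "(u, v) \<in> parcs ?G \<longleftrightarrow> (\<exists>xs i. i # xs \<in> ?B \<and>
      (u = f xs \<and> v = f (i # xs) \<or> u = f (i # xs) \<and> v = f xs))" for u v
    unfolding complete_tree_def by auto
  have fin: "finite (pverts ?G)" unfolding V using finite_bounded_lists by blast
  have VV: "parcs ?G \<subseteq> pverts ?G \<times> pverts ?G"
    using bounded_lists_Cons by (auto simp: A V)
  have G: "pair_graph ?G"
  proof
    show "fst e \<in> pverts ?G" "snd e \<in> pverts ?G" if "e \<in> parcs ?G" for e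
      using VV that by auto
    show "finite (pverts ?G)" by (rule fin)
    show "finite (parcs ?G)" using finite_subset[OF VV] fin by blast
    show "fst e \<noteq> snd e" if "e \<in> parcs ?G" for e
    proof -
      obtain u v where e: "e = (u, v)" by (cases e)
      show ?thesis using that unfolding e A using eq bounded_lists_Cons by fastforce
    qed
    show "symmetric (with_proj ?G)"
      unfolding symmetric_def sym_def by (auto simp: A)
  qed
  interpret pair_graph ?G by (rule G)
  have reach: "f [] \<rightarrow>\<^sup>*\<^bsub>with_proj ?G\<^esub> f xs" if "xs \<in> ?B" for xs
    using that
  proof (induction xs)
    case Nil
    then show ?case by (intro reachable_refl) (auto simp: V)
  next
    case (Cons i xs)
    then have "f [] \<rightarrow>\<^sup>*\<^bsub>with_proj ?G\<^esub> f xs" using bounded_lists_Cons by blast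
    moreover have "(f xs, f (i # xs)) \<in> parcs ?G" using Cons.prems by (auto simp: A)
    ultimately show ?case by (rule reachable_adj_trans)
  qed
  have "[] \<in> ?B" using n by (simp add: bounded_lists_def)
  have "Digraph_Component.connected (with_proj ?G)"
    unfolding Digraph_Component.connected_def strongly_connected_def
  proof (intro conjI ballI)
    show "verts (with_proj (mk_symmetric (with_proj ?G))) \<noteq> {}"
      using \<open>[] \<in> ?B\<close> by (auto simp: V)
    fix u v assume "u \<in> verts (with_proj (mk_symmetric (with_proj ?G)))"
      "v \<in> verts (with_proj (mk_symmetric (with_proj ?G)))"
    then have "f [] \<rightarrow>\<^sup>*\<^bsub>with_proj ?G\<^esub> u" "f [] \<rightarrow>\<^sup>*\<^bsub>with_proj ?G\<^esub> v"
      using reach by (auto simp: V)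
    then have "u \<rightarrow>\<^sup>*\<^bsub>with_proj ?G\<^esub> v"
      using symmetric_reachable' reachable_trans by blast
    then show "u \<rightarrow>\<^sup>*\<^bsub>with_proj (mk_symmetric (with_proj ?G))\<^esub> v"
      by (rule reachable_mk_symmetricI)
  qed
  moreover have "\<not> has_cycle ?G"
  proof (rule rooting_acyclic[OF _ pair_sym_arcs])
    let ?g = "the_inv_into ?B f"
    have g: "?g (f xs) = xs" if "xs \<in> ?B" for xs
      using f that by (rule the_inv_into_f_f)
    show "rooting ?G (length \<circ> ?g) (f \<circ> tl \<circ> ?g)"
      unfolding rooting_def
    proof (intro allI impI)
      fix u v assume "(u, v) \<in> parcs ?G"
      then obtain xs i where i: "i # xs \<in> ?B" "u = f xs \<and> v = f (i # xs) \<or> u = f (i # xs) \<and> v = f xs"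
        unfolding A by blast
      then have "?g (f (i # xs)) = i # xs" "?g (f xs) = xs" using g bounded_lists_Cons by blast+
      with i(2) show "v = (f \<circ> tl \<circ> ?g) u \<and> (length \<circ> ?g) u = Suc ((length \<circ> ?g) v) \<or>
          u = (f \<circ> tl \<circ> ?g) v \<and> (length \<circ> ?g) v = Suc ((length \<circ> ?g) u)"
        by auto
    qed
  qed
  ultimately show ?thesis using G by (simp add: trees_def)
qed

text \<open>Below \<open>xs\<close> there is a complete binary subtree whose levels are colored according to \<open>w\<close>.\<close>

primrec level_word :: "nat \<Rightarrow> (nat list \<Rightarrow> nat) \<Rightarrow> nat list \<Rightarrow> nat list \<Rightarrow> bool" where
  "level_word b c [] xs \<longleftrightarrow> True"
| "level_word b c (a # w) xs \<longleftrightarrow> c xs = a \<and>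
    (\<exists>i<b. \<exists>j<b. i \<noteq> j \<and> level_word b c w (i # xs) \<and> level_word b c w (j # xs))"

text \<open>Pigeonhole: each of the \<open>b\<close> children has a word of length \<open>l\<close>
  by induction, and there are at most \<open>C ^ l < b\<close> such words, so two children share
  one.\<close>

lemma level_word_exists:
  assumes "\<And>xs. xs \<in> bounded_lists b n \<Longrightarrow> c xs < C" "\<And>l. l < n \<Longrightarrow> C ^ l < b"
    and "set xs \<subseteq> {..<b}" "length xs + l \<le> n"
  shows "\<exists>w. length w = l \<and> set w \<subseteq> {..<C} \<and> level_word b c w xs"
  using assms(3,4)
proof (induction l arbitrary: xs)
  case (Suc l)
  have "\<exists>w. length w = l \<and> set w \<subseteq> {..<C} \<and> level_word b c w (i # xs)" if "i < b" for i
    using Suc.prems that by (intro Suc.IH) auto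
  then obtain g where g: "length (g i) = l" "set (g i) \<subseteq> {..<C}" "level_word b c (g i) (i # xs)"
    if "i < b" for i
    by metis
  have "\<not> inj_on g {..<b}"
  proof
    assume "inj_on g {..<b}"
    moreover have "g ` {..<b} \<subseteq> {w. set w \<subseteq> {..<C} \<and> length w = l}" using g by blast
    ultimately have "b \<le> C ^ l"
      using card_inj_on_le[of g "{..<b}" "{w. set w \<subseteq> {..<C} \<and> length w = l}"]
      by (simp add: finite_lists_length_eq card_lists_length_eq)
    with assms(2)[of l] Suc.prems show False by simp
  qed
  then obtain i j where "i < b" "j < b" "g i = g j" "i \<noteq> j" by (auto simp: inj_on_def)
  then have "level_word b c (c xs # g i) xs" using g by (metis level_word.simps(2))
  moreover have "c xs < C" using assms(1) Suc.prems by (auto simp: bounded_lists_def)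
  ultimately show ?case using g[OF \<open>i < b\<close>]
    by (intro exI[of _ "c xs # g i"]) (simp del: level_word.simps)
qed auto

text \<open>Follows a single branch. The binary subtree below each node is kept in the conclusion,
  so that the branch can later be split at any level.\<close>

lemma level_word_descend:
  assumes "level_word b c w xs"
  shows "\<exists>g. \<forall>l<length w. c (g l @ xs) = w ! l \<and> level_word b c (drop l w) (g l @ xs) \<and>
    length (g l) = l \<and> set (g l) \<subseteq> {..<b} \<and> (\<forall>l'. l = Suc l' \<longrightarrow> (\<exists>i. g l = i # g l'))"
  using assms
proof (induction w arbitrary: xs)
  case (Cons a w)
  then obtain i where i: "i < b" "level_word b c w (i # xs)" by auto
  obtain g where g: "c (g l @ i # xs) = w ! l" "level_word b c (drop l w) (g l @ i # xs)"
    "length (g l) = l" "set (g l) \<subseteq> {..<b}" "\<forall>l'. l = Suc l' \<longrightarrow> (\<exists>i. g l = i # g l')"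
    if "l < length w" for l
    using Cons.IH[OF i(2)] by blast
  define g' where "g' l = (case l of 0 \<Rightarrow> [] | Suc l \<Rightarrow> g l @ [i])" for l
  have "c (g' l @ xs) = (a # w) ! l \<and> level_word b c (drop l (a # w)) (g' l @ xs) \<and>
    length (g' l) = l \<and> set (g' l) \<subseteq> {..<b} \<and> (\<forall>l'. l = Suc l' \<longrightarrow> (\<exists>i. g' l = i # g' l'))"
    if "l < length (a # w)" for l
  proof (cases l)
    case 0
    then show ?thesis using Cons.prems by (auto simp: g'_def)
  next
    case (Suc l')
    then show ?thesis
      using g[of l'] i(1) that
      by (cases l') (auto simp: g'_def)
  qed
  then show ?case by blast
qed simp

text \<open>
  A folded square of the word of levels is realized by a path that climbs to the fold through one
  child and descends through another one with the same word of levels.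
\<close>

lemma complete_tree_contains_square:
  assumes f: "inj_on f (bounded_lists b n)"
    and w: "level_word b (c \<circ> f) w []" "length w = n" "\<not> fold_free k n ((!) w)"
  shows "\<exists>p\<ge>k. contains_square (complete_tree f b n) c p"
proof -
  let ?G = "complete_tree f b n"
  obtain m t p where p: "k \<le> p" "t < p" "m + (2 * p - t) \<le> n" "fold_square ((!) w) m t p"
    using w(3) unfolding fold_free_def by blast
  have m: "m < length w" using p w(2) by linarith
  \<comment> \<open>\<open>z\<close> is the node at level \<open>m\<close> where the path will
    fold.\<close>
  obtain z where z: "(c \<circ> f) z = w ! m" "level_word b (c \<circ> f) (drop m w) z" "length z = m" "set z \<subseteq> {..<b}"
    using level_word_descend[OF w(1)] m by fastforce
  define v where "v = drop (Suc m) w"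
  have v: "drop m w = w ! m # v" "length v = n - Suc m" "\<And>l. l < length v \<Longrightarrow> v ! l = w ! (Suc m + l)"
    using m w(2) by (auto simp: v_def Cons_nth_drop_Suc)
  obtain i j where ij: "i < b" "j < b" "i \<noteq> j" "level_word b (c \<circ> f) v (i # z)" "level_word b (c \<circ> f) v (j # z)"
    using z(2) unfolding v(1) by auto
  \<comment> \<open>A branch from \<open>z\<close> through its child \<open>q # z\<close>, reading
    \<open>w\<close> from position \<open>m\<close> on. Recording that child separates branches
    through different children.\<close>
  have chain: "\<exists>g. g 0 = z \<and> (\<forall>l. l < n - m \<longrightarrow> (c \<circ> f) (g l) = w ! (m + l) \<and> g l \<in> bounded_lists b n \<and>
      length (g l) = m + l) \<and> (\<forall>l. Suc l < n - m \<longrightarrow> (\<exists>i. g (Suc l) = i # g l) \<and> (\<exists>ys. g (Suc l) = ys @ q # z))"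
    if q: "q < b" "level_word b (c \<circ> f) v (q # z)" for q
  proof -
    obtain h where h: "(c \<circ> f) (h l @ q # z) = v ! l" "length (h l) = l" "set (h l) \<subseteq> {..<b}"
      "\<forall>l'. l = Suc l' \<longrightarrow> (\<exists>i. h l = i # h l')" if "l < length v" for l
      using level_word_descend[OF q(2)] by blast
    define g where "g l = (case l of 0 \<Rightarrow> z | Suc l \<Rightarrow> h l @ q # z)" for l
    have "(c \<circ> f) (g l) = w ! (m + l) \<and> g l \<in> bounded_lists b n \<and> length (g l) = m + l"
      if "l < n - m" for l
    proof (cases l)
      case 0
      then show ?thesis using z m w(2) by (simp add: g_def bounded_lists_def)
    next
      case (Suc l')
      then have l': "l' < length v" using that v(2) by simp
      show ?thesis
        using h[OF l'] v(3)[OF l'] Suc that z q(1) by (auto simp: g_def bounded_lists_def)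
    qed
    moreover have "(\<exists>i. g (Suc l) = i # g l) \<and> (\<exists>ys. g (Suc l) = ys @ q # z)" if "Suc l < n - m" for l
    proof -
      have "l < length v" using that v(2) by simp
      then show ?thesis using h[of l] by (cases l) (auto simp: g_def)
    qed
    ultimately show ?thesis by (intro exI[of _ g]) (simp add: g_def)
  qed
  obtain g1 where g1: "g1 0 = z" "\<And>l. l < n - m \<Longrightarrow> (c \<circ> f) (g1 l) = w ! (m + l)"
    "\<And>l. l < n - m \<Longrightarrow> g1 l \<in> bounded_lists b n" "\<And>l. l < n - m \<Longrightarrow> length (g1 l) = m + l"
    "\<And>l. Suc l < n - m \<Longrightarrow> \<exists>i. g1 (Suc l) = i # g1 l"
    "\<And>l. Suc l < n - m \<Longrightarrow> \<exists>ys. g1 (Suc l) = ys @ i # z"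
    using chain[OF ij(1,4)] by blast
  obtain g2 where g2: "g2 0 = z" "\<And>l. l < n - m \<Longrightarrow> (c \<circ> f) (g2 l) = w ! (m + l)"
    "\<And>l. l < n - m \<Longrightarrow> g2 l \<in> bounded_lists b n" "\<And>l. l < n - m \<Longrightarrow> length (g2 l) = m + l"
    "\<And>l. Suc l < n - m \<Longrightarrow> \<exists>i. g2 (Suc l) = i # g2 l"
    "\<And>l. Suc l < n - m \<Longrightarrow> \<exists>ys. g2 (Suc l) = ys @ j # z"
    using chain[OF ij(2,5)] by blast
  \<comment> \<open>The path climbs along \<open>g1\<close> from level \<open>m + t\<close>, reaches
    \<open>z = g2 0\<close> at index \<open>t\<close>, and descends along \<open>g2\<close>.\<close>
  define P where "P a = (if a < t then g1 (t - a) else g2 (a - t))" for a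
  have P: "(c \<circ> f) (P a) = w ! (m + ((a - t) + (t - a)))" "P a \<in> bounded_lists b n"
    "length (P a) = m + ((a - t) + (t - a))" if "a < 2 * p" for a
    using g1(2-4)[of "t - a"] g2(2-4)[of "a - t"] p that by (auto simp: P_def)
  have step: "(f (P a), f (P (Suc a))) \<in> parcs ?G" if "Suc a < 2 * p" for a
  proof -
    have "(\<exists>i. P a = i # P (Suc a)) \<or> (\<exists>i. P (Suc a) = i # P a)"
    proof (cases "a < t")
      case True
      then have "t - a = Suc (t - Suc a)" "P (Suc a) = g1 (t - Suc a)"
        using g1(1) g2(1) by (auto simp: P_def not_less_eq Suc_diff_Suc)
      with True g1(5)[of "t - Suc a"] p show ?thesis by (auto simp: P_def)
    next
      case False
      then have "Suc a - t = Suc (a - t)" by simp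
      with False g2(5)[of "a - t"] p that show ?thesis by (auto simp: P_def)
    qed
    moreover have "P a \<in> bounded_lists b n" "P (Suc a) \<in> bounded_lists b n" using P(2) that by auto
    ultimately show ?thesis unfolding complete_tree_def by fastforce
  qed
  \<comment> \<open>Equal nodes have equal levels, so they lie on opposite sides of the fold, hence
    under different children of \<open>z\<close>.\<close>
  have neq: "P a \<noteq> P a'" if "a < a'" "a' < 2 * p" for a a'
  proof
    assume eq: "P a = P a'"
    then have "(a - t) + (t - a) = (a' - t) + (t - a')" using P(3)[of a] P(3)[of a'] that by simp
    then have *: "a < t" "t < a'" "t - a = a' - t" using that by linarith+
    define l where "l = t - a - 1"
    have l: "Suc l < n - m" using * p that unfolding l_def by linarith
    have "t - a = Suc l" "a' - t = Suc l" using * by (simp_all add: l_def)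
    then have "P a = g1 (Suc l)" "P a' = g2 (Suc l)" using * by (auto simp: P_def)
    then obtain ys ys' where "P a = ys @ i # z" "P a' = ys' @ j # z"
      using g1(6)[OF l] g2(6)[OF l] by metis
    then show False using eq ij(3) by (simp add: append_eq_append_conv)
  qed
  let ?vs = "map (\<lambda>a. f (P a)) [0..<2 * p]"
  have "vpath ?vs (with_proj ?G)"
    unfolding vpath_with_proj_iff
  proof (intro conjI)
    show "?vs \<noteq> []" using p by simp
    show "set ?vs \<subseteq> pverts ?G" using P(2) by (auto simp: complete_tree_def)
    have "inj_on (\<lambda>a. f (P a)) {0..<2 * p}"
    proof (rule inj_onI)
      fix a a' assume a: "a \<in> {0..<2 * p}" "a' \<in> {0..<2 * p}" "f (P a) = f (P a')"
      then have "P a = P a'" using f P(2) by (auto simp: inj_on_def)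
      with a neq show "a = a'" by (metis atLeastLessThan_iff linorder_neqE_nat)
    qed
    then show "distinct ?vs" by (simp add: distinct_map)
    show "successively (\<lambda>u v. (u, v) \<in> parcs ?G) ?vs"
      unfolding successively_conv_nth using step by simp
  qed
  moreover have "square_word p (map c ?vs)"
    unfolding square_word_def
  proof (intro exI conjI)
    let ?u = "map (\<lambda>a. c (f (P a))) [0..<p]"
    show "?u \<noteq> []" "length ?u = p" using p by simp_all
    have "c (f (P (p + a))) = c (f (P a))" if "a < p" for a
    proof -
      have "w ! (m + ((a - t) + (t - a))) = w ! (m + (a + p - t))"
        using p(4) that unfolding fold_square_def by blast
      then show ?thesis using P(1)[of a] P(1)[of "p + a"] that p(2) by (simp add: add.commute)
    qed
    then have "c (f (P a)) = c (f (P (a - p)))" if "a < 2 * p" "\<not> a < p" for a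
      using that by (metis add_diff_inverse_nat add_less_cancel_left mult_2)
    then show "map c ?vs = ?u @ ?u"
      by (intro nth_equalityI) (auto simp: nth_append)
  qed
  ultimately have "contains_square ?G c p" unfolding contains_square_def by blast
  with p(1) show ?thesis by blast
qed

text \<open>The reduction to words: words with \<open>Suc C\<close> letters color every tree, while
  one complete tree with \<open>n\<close> levels cannot be colored with \<open>C\<close>
  colors.\<close>

lemma pi_class_trees_eq:
  assumes "0 < k" and upper: "\<And>N. \<exists>w. fold_free k N w \<and> (\<forall>i<N. w i < Suc C)"
    and lower: "\<And>w. set w \<subseteq> {..<C} \<Longrightarrow> length w = n \<Longrightarrow> \<not> fold_free k n ((!) w)"
  shows "pi_class k (trees :: 'a :: infinite pair_pre_digraph set) = enat (Suc C)"
proof (rule antisym)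
  show "pi_class k (trees :: 'a pair_pre_digraph set) \<le> enat (Suc C)"
    unfolding pi_class_def
  proof (rule SUP_least)
    fix G :: "'a pair_pre_digraph" assume "G \<in> trees"
    then have "avoiding_colorable k G (Suc C)"
      using assms(1) upper by (rule trees_avoiding_colorable)
    then show "enat (pi_graph k G) \<le> enat (Suc C)"
      unfolding pi_graph_def by (simp add: Least_le)
  qed
  have "fold_free k 0 ((!) [] :: nat \<Rightarrow> nat)" by (auto simp: fold_free_def)
  \<comment> \<open>No folded square fits into an empty prefix, so \<open>lower\<close> fails for
    \<open>n = 0\<close>; the complete tree thus has a root.\<close>
  then have "0 < n" using lower[of "[]"] by (cases n) auto
  \<comment> \<open>The base \<open>Suc C\<close> keeps the powers increasing even for
    \<open>C = 0\<close>.\<close>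
  define b where "b = Suc (Suc C ^ n)"
  have b: "C ^ l < b" if "l < n" for l
  proof -
    have "C ^ l \<le> Suc C ^ l" by (rule power_mono) auto
    also have "\<dots> \<le> Suc C ^ n" using that by (intro power_increasing) auto
    finally show ?thesis by (simp add: b_def)
  qed
  obtain f :: "nat list \<Rightarrow> 'a" where f: "inj_on f (bounded_lists b n)"
    using arb_inj_on_finite_infinite[OF finite_bounded_lists] by blast
  define G where "G = complete_tree f b n"
  have G: "G \<in> trees" unfolding G_def using f \<open>0 < n\<close> by (rule complete_tree_in_trees)
  have "\<not> pi_graph k G \<le> C"
  proof
    assume le: "pi_graph k G \<le> C"
    have "pair_graph G" using G by (simp add: trees_def)
    then obtain c :: "'a \<Rightarrow> nat" where c: "c ` pverts G \<subseteq> {..<pi_graph k G}"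
      "\<And>p. k \<le> p \<Longrightarrow> \<not> contains_square G c p"
      using avoiding_colorable_pi_graph unfolding avoiding_colorable_def by blast
    have "(c \<circ> f) xs < C" if "xs \<in> bounded_lists b n" for xs
      using c(1) le that by (force simp: G_def complete_tree_def)
    then obtain w where w: "length w = n" "set w \<subseteq> {..<C}" "level_word b (c \<circ> f) w []"
      using level_word_exists[of b n "c \<circ> f" C "[]" n] b by auto
    then show False
      using complete_tree_contains_square[OF f w(3,1) lower[OF w(2,1)]] c(2) unfolding G_def by blast
  qed
  then have "enat (Suc C) \<le> enat (pi_graph k G)" by simp
  also have "\<dots> \<le> pi_class k (trees :: 'a pair_pre_digraph set)"
    unfolding pi_class_def using G by (rule SUP_upper)
  finally show "enat (Suc C) \<le> pi_class k (trees :: 'a pair_pre_digraph set)" .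
qed

section \<open>The three cases\<close>

lemma fold_free_mono: "fold_free k N w \<Longrightarrow> k \<le> k' \<Longrightarrow> fold_free k' N w"
  unfolding fold_free_def by (meson le_trans)

theorem theorem3:
  shows "pi_class 1 (trees :: 'a::infinite pair_pre_digraph set) = 4 \<and>
    (\<forall>k. 2 \<le> k \<and> k \<le> 4 \<longrightarrow> pi_class k (trees :: 'a pair_pre_digraph set) = 3) \<and>
    (\<forall>k\<ge>5. pi_class k (trees :: 'a pair_pre_digraph set) = 2)"
proof (intro conjI allI impI)
  have "pi_class 1 (trees :: 'a pair_pre_digraph set) = enat (Suc 3)"
  proof (rule pi_class_trees_eq)
    show "\<exists>w. fold_free 1 N w \<and> (\<forall>i<N. w i < Suc 3)" for N using fold_free_4 by simp
  qed (use not_fold_free_ternary in auto)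
  then show "pi_class 1 (trees :: 'a pair_pre_digraph set) = 4" by (simp add: numeral_eq_enat)
next
  fix k :: nat assume k: "2 \<le> k \<and> k \<le> 4"
  have "pi_class k (trees :: 'a pair_pre_digraph set) = enat (Suc 2)"
  proof (rule pi_class_trees_eq)
    show "\<exists>w. fold_free k N w \<and> (\<forall>i<N. w i < Suc 2)" for N
    proof -
      obtain w :: "nat \<Rightarrow> nat" where "fold_free 2 N w" "\<forall>i<N. w i < 3" using fold_free_3 by blast
      with fold_free_mono k show ?thesis by (intro exI[of _ w]) auto
    qed
    \<comment> \<open>The binary search for \<open>k = 4\<close> also covers smaller
      \<open>k\<close>, since freeness for \<open>k\<close> is inherited by larger values.\<close>
    show "\<not> fold_free k 15 ((!) w)" if "set w \<subseteq> {..<2}" "length w = 15" for w :: "nat list"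
      using not_fold_free_binary[OF that] fold_free_mono k by blast
  qed (use k in simp)
  then show "pi_class k (trees :: 'a pair_pre_digraph set) = 3" by (simp add: numeral_eq_enat)
next
  fix k :: nat assume k: "5 \<le> k"
  have "pi_class k (trees :: 'a pair_pre_digraph set) = enat (Suc 1)"
  proof (rule pi_class_trees_eq)
    show "\<exists>w. fold_free k N w \<and> (\<forall>i<N. w i < Suc 1)" for N
    proof -
      obtain w :: "nat \<Rightarrow> nat" where "fold_free 5 N w" "\<forall>i<N. w i < 2" using fold_free_2 by blast
      with fold_free_mono k show ?thesis by (intro exI[of _ w]) auto
    qed
    show "\<not> fold_free k (2 * k) ((!) w)" if "set w \<subseteq> {..<1}" "length w = 2 * k" for w :: "nat list"
      using not_fold_free_unary[OF that] k by simp
  qed (use k in simp)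
  then show "pi_class k (trees :: 'a pair_pre_digraph set) = 2" by (simp add: numeral_eq_enat)
qed

end
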